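(* Let $\xi_1,\ldots,\xi_n$ (with $\xi_i=(Y_i,X_i)$) be $n$ independent and identically distributed observations with distribution $P$ taking values in $\{0,1\}\times\mathbb{R}^p$. Let $\{\mathcal{G}_m\}_{m\in\mathbb{N}}$ be a family of classes of classifiers $\mathbb{R}^p\to\{0,1\}$ with Vapnik-Chervonenkis dimension $V_{\mathcal{G}_m}<\infty$ for all $m\in\mathbb{N}$. Let $\alpha_{max}\in(0,1)$ and let $\Sigma$ be a non-negative constant. Let $\{x_m\}_{m\in\mathbb{N}}$ be a family of non-negative weights such that $$\sum_{m\in\mathbb{N}}e^{-x_m}\leq\Sigma<\infty.$$ Consider the penalization function $$pen(\alpha,\mathcal{G}_m)=\sqrt{\frac{\ln(n)+x_m}{2n(1-\alpha)^2}}+\frac{1}{1-\alpha}\sqrt{\frac{V_{\mathcal{G}_m}\ln(n+1)+\ln(2)}{n}}$$ and define $$(\hat{\alpha},\hat{m})=\operatorname*{arg\,min}_{(\alpha,m)\in[0,\alpha_{max}]\times\mathbb{N}}\left(R_{n,\alpha}(\mathcal{G}_m)+pen(\alpha,\mathcal{G}_m)\right).$$ Then $$E(R_{\hat{\alpha}}(\mathcal{G}_{\hat{m}}))\leq\min_{(\alpha,m)\in[0,\alpha_{max}]\times\mathbb{N}}\left(R_\alpha(\mathcal{G}_m)+pen(\alpha,\mathcal{G}_m)+\frac{\sqrt{R(\mathcal{G}_m)}}{\sqrt{2n}(1-\alpha)}\right)+\frac{1+\Sigma}{2(1-\alpha_{max})}\sqrt{\frac{\pi}{2n}}+\frac{1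}{n(1-\alpha_{max})^2}.$$
   Context: A classifier is a (measurable) function $g:\mathbb{R}^p\to\{0,1\}$. Its classification error is $R(g)=P(\{(y,x)\in\{0,1\}\times\mathbb{R}^p: y\neq g(x)\})$. For a trimming level $\alpha\in[0,1)$, the set of $\alpha$-trimmed versions of a probability $P$ on $\{0,1\}\times\mathbb{R}^p$ is $\mathcal{R}_\alpha(P)=\{Q \text{ probability on } \{0,1\}\times\mathbb{R}^p: Q\ll P,\ \frac{dQ}{dP}\leq\frac{1}{1-\alpha}\ P\text{-a.s.}\}$ (so $\mathcal{R}_0(P)=\{P\}$). The trimmed classification error of $g$ is $R_\alpha(g)=\inf_{Q\in\mathcal{R}_\alpha(P)}Q(\{(y,x): g(x)\neq y\})$. The empirical trimmed classification error based on the sample $(Y_1,X_1),\dots,(Y_n,X_n)$ is $$R_{n,\alpha}(g)=\min_{w\in W}\sum_{i=1}^n w_i I_{(g(X_i)\neq Y_i)},\qquad W=\Big\{(w_1,\ldots,w_n): 0\leq w_i\leq\tfrac{1}{n(1-\alpha)},\ \sum_{i=1}^n w_i=1\Big\};$$ equivalently it is $\inf_{Q\in\mathcal{R}_\alpha(P_n)}Q(g(x)\neq y)$ where $P_n$ is the empirical distribution of the sample. For a class $\mathcal{G}$ of classifiers, $R(\mathcal{G})=\min_{g\in\mathcal{G}}R(g)$, $R_\alpha(\mathcal{G})=\min_{g\in\mathcal{G}}R_\alpha(g)$ and $R_{n,\alpha}(\mathcal{G})=\min_{g\in\mathcal{G}}R_{n,\alpha}(g)$; it is assumed that a classifier minimizing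 $R$ over the class exists. The Vapnik-Chervonenkis dimension $V_{\mathcal{G}}$ is that of the collection of sets $\{(y,x): g(x)\neq y\}$, $g\in\mathcal{G}$ (equivalently, of the sets $\{x: g(x)=1\}$, $g\in\mathcal{G}$). $(\hat\alpha,\hat m)$ is a (random, data-dependent) minimizer, $R_{\hat\alpha}(\mathcal{G}_{\hat m})$ denotes $R_\alpha(\mathcal{G}_m)$ evaluated at $(\alpha,m)=(\hat\alpha,\hat m)$, and $E$ is expectation with respect to the sample.
   Formalization: Each class of classifiers is also assumed measurable: for all k and labels, the set of k-tuples of points on which some classifier of the class takes these labels is Borel. Without such a condition the expectation may be undefined, and under the continuum hypothesis the bound can fail. *)

theory Defs
  imports "HOL-Probability.Probability" "HOL-Library.Extended_Nat"
begin

text \<open>Labels in $\{0,1\}$ are encoded as booleans (\<open>False\<close> for 0, \<open>True\<close> for 1);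
  an observation is a pair (label, feature vector).\<close>

abbreviation obs_space :: "(bool \<times> (real ^ 'p)) measure" where
  "obs_space \<equiv> count_space UNIV \<Otimes>\<^sub>M borel"

abbreviation classifiers :: "(real ^ 'p \<Rightarrow> bool) set" where
  "classifiers \<equiv> borel \<rightarrow>\<^sub>M count_space UNIV"

definition error_set :: "('x \<Rightarrow> bool) \<Rightarrow> (bool \<times> 'x) set" where
  "error_set g = {(y, x). g x \<noteq> y}"

text \<open>The minima below are written as infima of reals; the infima over
  classifiers, weights and trimmings are over nonempty sets of numbers in the unit
  interval whenever the class is nonempty and the trimming level lies in $[0,1)$.\<close>

definition risk :: "(bool \<times> 'x) measure \<Rightarrow> ('x \<Rightarrow> bool) \<Rightarrow> real" where
  "risk P g = measure P (error_set g)"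

definition class_risk :: "(bool \<times> 'x) measure \<Rightarrow> ('x \<Rightarrow> bool) set \<Rightarrow> real" where
  "class_risk P G = (INF g\<in>G. risk P g)"

definition trimmings :: "real \<Rightarrow> 'a measure \<Rightarrow> 'a measure set" where
  "trimmings \<alpha> P = {Q. prob_space Q \<and> sets Q = sets P \<and> absolutely_continuous P Q \<and>
      (AE z in P. RN_deriv P Q z \<le> ennreal (1 / (1 - \<alpha>)))}"

definition trimmed_risk :: "(bool \<times> 'x) measure \<Rightarrow> real \<Rightarrow> ('x \<Rightarrow> bool) \<Rightarrow> real" where
  "trimmed_risk P \<alpha> g = (INF Q\<in>trimmings \<alpha> P. measure Q (error_set g))"

definition class_trimmed_risk ::
    "(bool \<times> 'x) measure \<Rightarrow> real \<Rightarrow> ('x \<Rightarrow> bool) set \<Rightarrow> real" where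
  "class_trimmed_risk P \<alpha> G = (INF g\<in>G. trimmed_risk P \<alpha> g)"

text \<open>A sample of size \<open>n\<close> is a function on the indices \<open>i < n\<close>; values at other indices
  are irrelevant, and the same holds for weight vectors.\<close>

definition trim_weights :: "nat \<Rightarrow> real \<Rightarrow> (nat \<Rightarrow> real) set" where
  "trim_weights n \<alpha> =
     {w. (\<forall>i<n. 0 \<le> w i \<and> w i \<le> 1 / (real n * (1 - \<alpha>))) \<and> (\<Sum>i<n. w i) = 1}"

definition emp_trimmed_risk ::
    "nat \<Rightarrow> (nat \<Rightarrow> bool \<times> 'x) \<Rightarrow> real \<Rightarrow> ('x \<Rightarrow> bool) \<Rightarrow> real" where
  "emp_trimmed_risk n z \<alpha> g =
     (INF w\<in>trim_weights n \<alpha>. \<Sum>i<n. w i * indicat_real (error_set g) (z i))"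

definition class_emp_trimmed_risk ::
    "nat \<Rightarrow> (nat \<Rightarrow> bool \<times> 'x) \<Rightarrow> real \<Rightarrow> ('x \<Rightarrow> bool) set \<Rightarrow> real" where
  "class_emp_trimmed_risk n z \<alpha> G = (INF g\<in>G. emp_trimmed_risk n z \<alpha> g)"

definition shatters :: "'a set set \<Rightarrow> 'a set \<Rightarrow> bool" where
  "shatters \<C> A \<longleftrightarrow> (\<forall>B\<subseteq>A. \<exists>C\<in>\<C>. A \<inter> C = B)"

text \<open>Convention: the largest cardinality of a shattered set (not the smallest cardinality
  at which shattering fails).\<close>

definition vc_dim :: "'a set set \<Rightarrow> enat" where
  "vc_dim \<C> = (SUP A\<in>{A. finite A \<and> shatters \<C> A}. enat (card A))"

definition class_vc_dim :: "('x \<Rightarrow> bool) set \<Rightarrow> enat" where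
  "class_vc_dim G = vc_dim (error_set ` G)"

text \<open>Measurability of a (possibly uncountable) class: for all labels
  $b_0,\dots,b_{k-1}$, the set of $(x_0,\dots,x_{k-1})$ on which some member of the class
  takes these labels is measurable. Equivalently, every supremum over the class of a
  weighted empirical error $\sum_{i<k} e_i I(g(x_i) \neq y_i)$ is a measurable function of
  $((y_i,x_i))_{i<k}$. Uniform deviation bounds for classes of finite Vapnik-Chervonenkis
  dimension presuppose a condition of this kind: under the continuum hypothesis they fail
  for the countable initial segments of a well-ordering of the line of type $\omega_1$.\<close>

definition measurable_class :: "('x::topological_space \<Rightarrow> bool) set \<Rightarrow> bool" where
  "measurable_class G \<longleftrightarrow>
     (\<forall>k (b :: nat \<Rightarrow> bool).
        {x \<in> space (PiM {..<k} (\<lambda>_. borel)). \<exists>g\<in>G. \<forall>i<k. g (x i) = b i}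
          \<in> sets (PiM {..<k} (\<lambda>_. borel)))"

text \<open>\<open>t\<close> is the weight $x_m$ attached to the class.\<close>

definition pen :: "nat \<Rightarrow> real \<Rightarrow> real \<Rightarrow> ('x \<Rightarrow> bool) set \<Rightarrow> real" where
  "pen n t \<alpha> G =
     sqrt ((ln (real n) + t) / (2 * real n * (1 - \<alpha>)\<^sup>2)) +
     1 / (1 - \<alpha>) *
       sqrt ((real (the_enat (class_vc_dim G)) * ln (real n + 1) + ln 2) / real n)"

end

theory Submission
  imports Defs
begin

text \<open>
  Optimal trimming puts the largest admitted mass on the correctly classified observations, so it
  turns an error probability \<open>r\<close> into \<open>max 0 ((r - \<alpha>) / (1 - \<alpha>))\<close>. This function,
  \<open>trim \<alpha>\<close> below, is the same for \<open>P\<close> and for the empirical distribution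
  (\<open>trimmed_risk_eq_trim\<close>, \<open>emp_trimmed_risk_eq_trim\<close>); it is nondecreasing and Lipschitz
  with constant \<open>1 / (1 - \<alpha>)\<close>. Write $R(m)$ for the risk of the class \<open>G m\<close>, $R_n(m)$ for
  its smallest empirical error frequency, and \<open>pen = (s + v) / (1 - \<alpha>)\<close> with \<open>s\<close>, \<open>v\<close> the two
  square roots at \<open>\<alpha> = 0\<close>. All trimming levels are then governed by the single family of
  deviations $D_m = R(m) - R_n(m)$, and no union bound over \<open>\<alpha>\<close> is required.

  Comparing the data-driven pair with an arbitrary pair \<open>(\<alpha>, m)\<close> bounds the selected trimmed
  risk by the criterion at \<open>(\<alpha>, m)\<close> plus
  $(\max(0, D_{\hat m}) - s_{\hat m} - v_{\hat m}) / (1 - \hat\alpha)$.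
  In the criterion, $R_n(m)$ is at most the error frequency of one fixed optimal classifier, whose
  expected positive deviation is bounded through its variance (\<open>integral_freq_excess_le\<close>); this
  is the term with the square root of the risk. The remaining deviation is, up to the factor
  \<open>1 / (1 - \<alpha>max)\<close>, at most $1/n$ plus the sum over all \<open>m\<close> of
  $\max(0, D_m - s_m - v_m - 1/n)$, and the expectation of the \<open>m\<close>-th summand is at most
  $e^{-x_m} / (4 n)$ (\<open>expected_excess_le\<close>), which is summable by assumption.

  The last estimate is a Chernoff bound whose constants leave little room: the exponential moment
  of $D_m$ at \<open>\<lambda>\<close> has to be about $(n+1)^{2V} e^{\lambda^2/(8n)}$, with the same variance factor as
  for a single event, since $2 n v_m^2 = 2 V \ln(n+1) + 2 \ln 2$ and $2 n s_m^2 = \ln n + x_m$.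
  Symmetrization with a ghost sample of size \<open>n\<close> loses a constant factor in the exponent, which
  the penalty does not allow. A ghost sample of size $n^2$ loses much less: attach \<open>n\<close>
  ghosts to every observation, and exchange the observation with a uniformly chosen member of its
  block of $n+1$ exchangeable points. Given the unordered blocks, ghost frequency minus sample
  frequency is a sum of \<open>n\<close> independent centred terms, each spread over an interval of length
  $(1 + 1/n)/n$, so that Hoeffding's lemma costs only a factor $(1+1/n)^2$ in the variance
  (\<open>average_gap_swaps_le\<close>), which the reserve of $1/n$ in the excess compensates. The class leaves
  at most $(n(n+1)+1)^V \le (n+1)^{2V}$ traces on all $n(n+1)$ points by the Sauer--Shelah
  lemma (\<open>card_traces_le\<close>).
\<close>

section \<open>Traces of a class with finite Vapnik-Chervonenkis dimension\<close>

text \<open>Pajor's form of the Sauer--Shelah lemma. Removing a point \<open>a\<close> splits a family into its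
  restriction to the other points and the family of those sets that occur both with and without
  \<open>a\<close>; what the latter shatters is still shattered after adding \<open>a\<close>.\<close>
lemma card_le_card_shattered:
  assumes "finite A" and "\<F> \<subseteq> Pow A"
  shows "card \<F> \<le> card {B. B \<subseteq> A \<and> shatters \<F> B}"
  using assms
proof (induction A arbitrary: \<F> rule: finite_induct)
  case empty
  then have "\<F> = {} \<or> \<F> = {{}}" by auto
  then show ?case
  proof
    assume "\<F> = {{}}"
    then have "{B::'a set. B \<subseteq> {} \<and> shatters \<F> B} = {{}}"
      by (auto simp: shatters_def)
    with \<open>\<F> = {{}}\<close> show ?case by simp
  qed simp
next
  case (insert a A)
  define F0 where "F0 = (\<lambda>C. C - {a}) ` \<F>"
  define F1 where "F1 = {C. a \<notin> C \<and> C \<in> \<F> \<and> insert a C \<in> \<F>}"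
  have finF: "finite \<F>"
    using insert.prems insert.hyps by (meson finite_Pow_iff finite_insert finite_subset)
  have F0: "F0 \<subseteq> Pow A" using insert.prems by (auto simp: F0_def)
  have F1: "F1 \<subseteq> Pow A" using insert.prems by (auto simp: F1_def)
  have "card \<F> = card F0 + card F1"
  proof -
    define X where "X = {C \<in> \<F>. a \<notin> C}"
    define Y where "Y = {C. a \<notin> C \<and> insert a C \<in> \<F>}"
    have finX: "finite X" using finF by (simp add: X_def)
    have Yim: "Y = (\<lambda>C. C - {a}) ` {C \<in> \<F>. a \<in> C}"
    proof (intro set_eqI iffI)
      fix C assume "C \<in> Y"
      then have "C = insert a C - {a}" "insert a C \<in> {C \<in> \<F>. a \<in> C}" by (auto simp: Y_def)
      then show "C \<in> (\<lambda>C. C - {a}) ` {C \<in> \<F>. a \<in> C}" by blast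
    qed (auto simp: Y_def insert_absorb)
    have finY: "finite Y" using finF by (simp add: Yim)
    have "card {C \<in> \<F>. a \<in> C} = card Y"
      unfolding Yim by (rule card_image[symmetric]) (auto simp: inj_on_def)
    moreover have "card \<F> = card X + card {C \<in> \<F>. a \<in> C}"
    proof -
      have "\<F> = X \<union> {C \<in> \<F>. a \<in> C}" by (auto simp: X_def)
      moreover have "X \<inter> {C \<in> \<F>. a \<in> C} = {}" by (auto simp: X_def)
      ultimately show ?thesis using finF finX by (metis card_Un_disjoint finite_Un)
    qed
    moreover have "F0 = X \<union> Y"
    proof -
      have "\<F> = X \<union> {C \<in> \<F>. a \<in> C}" by (auto simp: X_def)
      then have "F0 = (\<lambda>C. C - {a}) ` X \<union> Y" unfolding F0_def Yim by blast
      moreover have "(\<lambda>C. C - {a}) ` X = X" by (force simp: X_def)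
      ultimately show ?thesis by simp
    qed
    moreover have "F1 = X \<inter> Y" by (auto simp: F1_def X_def Y_def)
    ultimately show ?thesis using card_Un_Int[OF finX finY] by simp
  qed
  also have "\<dots> \<le> card {B. B \<subseteq> A \<and> shatters F0 B} + card {B. B \<subseteq> A \<and> shatters F1 B}"
    by (intro add_mono insert.IH F0 F1)
  also have "\<dots> = card ({B. B \<subseteq> A \<and> shatters F0 B} \<union>
      insert a ` {B. B \<subseteq> A \<and> shatters F1 B})"
  proof -
    have "card {B. B \<subseteq> A \<and> shatters F1 B} = card (insert a ` {B. B \<subseteq> A \<and> shatters F1 B})"
      using insert.hyps by (intro card_image[symmetric]) (auto simp: inj_on_def; blast)
    then show ?thesis
      using insert.hyps by (subst card_Un_disjoint) auto
  qed
  also have "\<dots> \<le> card {B. B \<subseteq> insert a A \<and> shatters \<F> B}"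
  proof (rule card_mono)
    show "finite {B. B \<subseteq> insert a A \<and> shatters \<F> B}" using insert.hyps by simp
    have "shatters \<F> B" if "B \<subseteq> A" "shatters F0 B" for B
      unfolding shatters_def
    proof (intro allI impI)
      fix D assume "D \<subseteq> B"
      with that obtain C where "C \<in> \<F>" "B \<inter> (C - {a}) = D"
        unfolding shatters_def F0_def by blast
      moreover have "a \<notin> B" using that insert.hyps by auto
      ultimately show "\<exists>C\<in>\<F>. B \<inter> C = D" by blast
    qed
    moreover have "shatters \<F> (insert a B)" if B: "B \<subseteq> A" "shatters F1 B" for B
      unfolding shatters_def
    proof (intro allI impI)
      fix D assume D: "D \<subseteq> insert a B"
      have "D - {a} \<subseteq> B" using D by auto
      with B obtain C where C: "C \<in> F1" "B \<inter> C = D - {a}"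
        unfolding shatters_def by blast
      have aC: "a \<notin> C" "C \<in> \<F>" "insert a C \<in> \<F>" using C by (auto simp: F1_def)
      have aB: "a \<notin> B" using B insert.hyps by auto
      show "\<exists>C\<in>\<F>. insert a B \<inter> C = D"
      proof (cases "a \<in> D")
        case True
        then have "insert a B \<inter> insert a C = D" using C(2) D by auto
        then show ?thesis using aC by blast
      next
        case False
        then have "insert a B \<inter> C = D" using C(2) D aC aB by auto
        then show ?thesis using aC by blast
      qed
    qed
    ultimately show "{B. B \<subseteq> A \<and> shatters F0 B} \<union> insert a ` {B. B \<subseteq> A \<and> shatters F1 B}
        \<subseteq> {B. B \<subseteq> insert a A \<and> shatters \<F> B}" by auto
  qed
  finally show ?case .
qed

text \<open>A subset with at most \<open>V\<close> elements is listed by a word of length \<open>V\<close> over the points and one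
  padding symbol, here \<open>None\<close>.\<close>
lemma card_small_subsets_le:
  assumes "finite A"
  shows "card {B. B \<subseteq> A \<and> card B \<le> V} \<le> (card A + 1) ^ V"
proof -
  let ?L = "{xs. set xs \<subseteq> insert None (Some ` A) \<and> length xs = V}"
  have "{B. B \<subseteq> A \<and> card B \<le> V} \<subseteq> (\<lambda>xs. {a. Some a \<in> set xs}) ` ?L"
  proof
    fix B assume "B \<in> {B. B \<subseteq> A \<and> card B \<le> V}"
    then have B: "B \<subseteq> A" "card B \<le> V" by auto
    obtain ys where ys: "set ys = B" "length ys = card B"
      using finite_subset[OF B(1) assms] by (metis distinct_card finite_distinct_list)
    let ?xs = "map Some ys @ replicate (V - card B) None"
    have "?xs \<in> ?L" using B ys by auto
    moreover have "B = {a. Some a \<in> set ?xs}" using ys by auto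
    ultimately show "B \<in> (\<lambda>xs. {a. Some a \<in> set xs}) ` ?L" by blast
  qed
  moreover have fin: "finite ?L" by (rule finite_lists_length_eq) (use assms in simp)
  ultimately have "card {B. B \<subseteq> A \<and> card B \<le> V} \<le> card ?L"
    by (meson card_image_le card_mono finite_imageI le_trans)
  also have "\<dots> = (card A + 1) ^ V"
    using assms by (subst card_lists_length_eq) (auto simp: card_image)
  finally show ?thesis .
qed

text \<open>Patterns are recorded on the indices rather than on the points, so that repeated observations and
  permutations of the sample need no special treatment.\<close>
definition traces :: "'a set set \<Rightarrow> nat \<Rightarrow> (nat \<Rightarrow> 'a) \<Rightarrow> nat set set" where
  "traces \<C> m w = (\<lambda>C. {k. k < m \<and> w k \<in> C}) ` \<C>"

lemma finite_traces [simp]: "finite (traces \<C> m w)"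
  by (rule finite_subset[of _ "Pow {..<m}"]) (auto simp: traces_def)

lemma card_traces_le:
  assumes V: "\<And>A. finite A \<Longrightarrow> shatters \<C> A \<Longrightarrow> card A \<le> V"
  shows "card (traces \<C> m w) \<le> (m + 1) ^ V"
proof -
  let ?A = "w ` {..<m}"
  let ?F = "(\<inter>) ?A ` \<C>"
  have "traces \<C> m w = (\<lambda>B. {k. k < m \<and> w k \<in> B}) ` ?F"
    unfolding traces_def image_image by (intro image_cong) auto
  then have "card (traces \<C> m w) \<le> card ?F"
    by (auto intro!: card_image_le finite_subset[of ?F "Pow ?A"])
  also have "\<dots> \<le> card {B. B \<subseteq> ?A \<and> shatters ?F B}"
    by (rule card_le_card_shattered) auto
  also have "\<dots> \<le> card {B. B \<subseteq> ?A \<and> card B \<le> V}"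
  proof (rule card_mono)
    have "card B \<le> V" if "B \<subseteq> ?A" "shatters ?F B" for B
    proof (rule V)
      show "finite B" using that by (meson finite_imageI finite_lessThan finite_subset)
      show "shatters \<C> B"
        unfolding shatters_def
      proof (intro allI impI)
        fix D assume "D \<subseteq> B"
        with that obtain C where "C \<in> \<C>" "B \<inter> (?A \<inter> C) = D"
          unfolding shatters_def by blast
        then show "\<exists>C\<in>\<C>. B \<inter> C = D" using that by blast
      qed
    qed
    then show "{B. B \<subseteq> ?A \<and> shatters ?F B} \<subseteq> {B. B \<subseteq> ?A \<and> card B \<le> V}" by auto
  qed simp
  also have "\<dots> \<le> (card ?A + 1) ^ V" by (rule card_small_subsets_le) simp
  also have "\<dots> \<le> (m + 1) ^ V"
    by (intro power_mono add_mono) (use card_image_le[of "{..<m}" w] in auto)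
  finally show ?thesis .
qed

lemma card_le_vc_dim:
  assumes "vc_dim \<C> < \<infinity>" "finite A" "shatters \<C> A"
  shows "card A \<le> the_enat (vc_dim \<C>)"
proof -
  have "enat (card A) \<le> vc_dim \<C>"
    unfolding vc_dim_def by (rule SUP_upper) (use assms in auto)
  then show ?thesis using assms(1) by (cases "vc_dim \<C>") auto
qed

section \<open>Trimming as a function of the error probability\<close>

text \<open>The smallest probability that an event of probability \<open>r\<close> can be given by \<open>\<alpha>\<close>-trimming.\<close>
definition trim :: "real \<Rightarrow> real \<Rightarrow> real" where
  "trim \<alpha> r = max 0 ((r - \<alpha>) / (1 - \<alpha>))"

lemma trim_nonneg: "0 \<le> trim \<alpha> r"
  by (simp add: trim_def)

lemma trim_mono: "\<alpha> < 1 \<Longrightarrow> r \<le> s \<Longrightarrow> trim \<alpha> r \<le> trim \<alpha> s"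
  unfolding trim_def by (intro max.mono divide_right_mono) auto

lemma trim_diff_le:
  assumes "\<alpha> < 1"
  shows "trim \<alpha> r \<le> trim \<alpha> s + max 0 (r - s) / (1 - \<alpha>)"
proof -
  have "(r - \<alpha>) / (1 - \<alpha>) = (s - \<alpha>) / (1 - \<alpha>) + (r - s) / (1 - \<alpha>)"
    by (simp add: diff_divide_distrib)
  moreover have "(r - s) / (1 - \<alpha>) \<le> max 0 (r - s) / (1 - \<alpha>)"
    using assms by (intro divide_right_mono) auto
  moreover have "0 \<le> max 0 (r - s) / (1 - \<alpha>)"
    using assms by simp
  ultimately show ?thesis unfolding trim_def by linarith
qed

text \<open>The bound on the density limits the mass that a trimming can move to the complement of the event.\<close>
lemma trim_le_trimming:
  assumes P: "prob_space P" and Q: "Q \<in> trimmings \<alpha> P" and A: "A \<in> sets P" and \<alpha>: "\<alpha> < 1"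
  shows "trim \<alpha> (measure P A) \<le> measure Q A"
proof -
  interpret P: prob_space P by fact
  interpret Q: prob_space Q using Q by (simp add: trimmings_def)
  have sQ: "sets Q = sets P" and ac: "absolutely_continuous P Q"
    and RN: "AE z in P. RN_deriv P Q z \<le> ennreal (1 / (1 - \<alpha>))"
    using Q by (auto simp: trimmings_def)
  have spQ: "space Q = space P" using sQ by (rule sets_eq_imp_space_eq)
  let ?B = "space P - A"
  have B: "?B \<in> sets P" using A by auto
  have "emeasure Q ?B = emeasure (density P (RN_deriv P Q)) ?B"
    using P.density_RN_deriv[OF ac sQ] by simp
  also have "\<dots> = (\<integral>\<^sup>+z. RN_deriv P Q z * indicator ?B z \<partial>P)"
    using B by (intro emeasure_density) auto
  also have "\<dots> \<le> (\<integral>\<^sup>+z. ennreal (1 / (1 - \<alpha>)) * indicator ?B z \<partial>P)"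
    using RN by (intro nn_integral_mono_AE) (auto elim!: eventually_mono intro!: mult_right_mono)
  also have "\<dots> = ennreal (1 / (1 - \<alpha>)) * emeasure P ?B"
    using B by (intro nn_integral_cmult_indicator)
  also have "\<dots> = ennreal (measure P ?B / (1 - \<alpha>))"
    using \<alpha> by (simp add: P.emeasure_eq_measure ennreal_mult[symmetric])
  finally have "measure Q ?B \<le> measure P ?B / (1 - \<alpha>)"
    using \<alpha> by (simp add: Q.emeasure_eq_measure)
  moreover have "measure Q ?B = 1 - measure Q A"
    using Q.prob_compl[of A] A sQ spQ by simp
  moreover have "measure P ?B = 1 - measure P A"
    using P.prob_compl[of A] A by simp
  ultimately have "1 - (1 - measure P A) / (1 - \<alpha>) \<le> measure Q A" by simp
  moreover have "1 - (1 - measure P A) / (1 - \<alpha>) = (measure P A - \<alpha>) / (1 - \<alpha>)"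
    using \<alpha> by (simp add: field_simps)
  ultimately show ?thesis unfolding trim_def by simp
qed

text \<open>The optimal trimming has a density that is constant on the event and on its complement: it is
  maximal on the complement, unless the complement alone can carry all the mass.\<close>
lemma ex_trimming_eq_trim:
  assumes P: "prob_space P" and A: "A \<in> sets P" and \<alpha>: "0 \<le> \<alpha>" "\<alpha> < 1"
  shows "\<exists>Q\<in>trimmings \<alpha> P. measure Q A = trim \<alpha> (measure P A)"
proof -
  interpret P: prob_space P by fact
  let ?B = "space P - A"
  define p where "p = measure P A"
  define u v where "u = (if p \<le> \<alpha> then 0 else trim \<alpha> p / p)"
    and "v = (if p \<le> \<alpha> then 1 / (1 - p) else 1 / (1 - \<alpha>))"
  have p: "0 \<le> p" "p \<le> 1" by (simp_all add: p_def)
  have B: "?B \<in> sets P" "measure P ?B = 1 - p"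
    using A P.prob_compl[of A] by (auto simp: p_def)
  have uv: "0 \<le> u" "0 \<le> v" "u \<le> 1 / (1 - \<alpha>)" "v \<le> 1 / (1 - \<alpha>)"
    "u * p + v * (1 - p) = 1" "u * p = trim \<alpha> p"
  proof -
    show "0 \<le> u" "0 \<le> v" using p \<alpha> by (auto simp: u_def v_def trim_nonneg)
    show "v \<le> 1 / (1 - \<alpha>)" using p \<alpha> by (auto simp: v_def frac_le)
    show *: "u * p = trim \<alpha> p" using p \<alpha> by (auto simp: u_def trim_def field_simps max_def)
    show "u \<le> 1 / (1 - \<alpha>)"
    proof (cases "p \<le> \<alpha>")
      case False
      then have "0 < p" using \<alpha> by simp
      moreover have "(p - \<alpha>) / (1 - \<alpha>) \<le> p / (1 - \<alpha>)"
        using \<alpha> by (intro divide_right_mono) auto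
      ultimately show ?thesis
        using False \<alpha> by (auto simp: u_def trim_def max_def field_simps)
    qed (use \<alpha> in \<open>simp add: u_def\<close>)
    show "u * p + v * (1 - p) = 1"
      unfolding * using p \<alpha> by (auto simp: trim_def v_def max_def divide_simps)
  qed
  define f where "f z = ennreal u * indicator A z + ennreal v * indicator ?B z" for z
  have f[measurable]: "f \<in> borel_measurable P" unfolding f_def using A B(1) by measurable
  define Q where "Q = density P f"
  have fle: "f z \<le> ennreal (1 / (1 - \<alpha>))" for z
    unfolding f_def using uv \<alpha> by (auto simp: indicator_def intro!: ennreal_leI)
  have em: "emeasure Q C = ennreal (u * measure P (A \<inter> C) + v * measure P (?B \<inter> C))"
    if C: "C \<in> sets P" for C
  proof -
    have "emeasure Q C = (\<integral>\<^sup>+z. f z * indicator C z \<partial>P)"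
      unfolding Q_def using C by (intro emeasure_density) auto
    also have "\<dots> = (\<integral>\<^sup>+z. ennreal u * indicator (A \<inter> C) z + ennreal v * indicator (?B \<inter> C) z \<partial>P)"
      by (intro nn_integral_cong) (auto simp: f_def indicator_def)
    also have "\<dots> = ennreal u * emeasure P (A \<inter> C) + ennreal v * emeasure P (?B \<inter> C)"
      using A B C by (subst nn_integral_add) (auto simp: nn_integral_cmult_indicator)
    finally show ?thesis
      using uv by (simp add: P.emeasure_eq_measure ennreal_mult[symmetric] ennreal_plus[symmetric] del: ennreal_plus)
  qed
  have Qp: "prob_space Q"
  proof
    have "A \<inter> space P = A" "?B \<inter> space P = ?B" using A sets.sets_into_space by auto
    then show "emeasure Q (space Q) = 1"
      using em[of "space P"] uv B by (simp add: Q_def p_def[symmetric])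
  qed
  then interpret Q: prob_space Q .
  have "AE z in P. RN_deriv P Q z \<le> ennreal (1 / (1 - \<alpha>))"
  proof -
    have "AE z in P. f z = RN_deriv P Q z"
      by (rule RN_deriv_unique_sigma_finite[OF f Q_def[symmetric]]) unfold_locales
    then show ?thesis by eventually_elim (use fle in metis)
  qed
  moreover have "absolutely_continuous P Q"
    unfolding Q_def by (rule absolutely_continuousI_density) simp
  ultimately have "Q \<in> trimmings \<alpha> P"
    using Qp by (simp add: trimmings_def Q_def)
  moreover have "measure Q A = trim \<alpha> (measure P A)"
  proof -
    have "?B \<inter> A = {}" by auto
    then have "emeasure Q A = ennreal (trim \<alpha> p)"
      using em[OF A] uv by (simp add: p_def[symmetric])
    then show ?thesis by (simp add: Q.emeasure_eq_measure trim_nonneg p_def)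
  qed
  ultimately show ?thesis by blast
qed

lemma trimmed_risk_eq_trim:
  assumes P: "prob_space P" and A: "error_set g \<in> sets P" and \<alpha>: "0 \<le> \<alpha>" "\<alpha> < 1"
  shows "trimmed_risk P \<alpha> g = trim \<alpha> (risk P g)"
proof -
  obtain Q where Q: "Q \<in> trimmings \<alpha> P" "measure Q (error_set g) = trim \<alpha> (risk P g)"
    using ex_trimming_eq_trim[OF P A \<alpha>] by (auto simp: risk_def)
  have lb: "trim \<alpha> (risk P g) \<le> measure Q' (error_set g)" if "Q' \<in> trimmings \<alpha> P" for Q'
    using trim_le_trimming[OF P that A \<alpha>(2)] by (simp add: risk_def)
  show ?thesis
    unfolding trimmed_risk_def
  proof (rule antisym)
    show "(INF Q\<in>trimmings \<alpha> P. measure Q (error_set g)) \<le> trim \<alpha> (risk P g)"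
      unfolding Q(2)[symmetric] by (rule cINF_lower) (use Q lb in \<open>auto intro: bdd_belowI2[where m = "trim \<alpha> (risk P g)"]\<close>)
    show "trim \<alpha> (risk P g) \<le> (INF Q\<in>trimmings \<alpha> P. measure Q (error_set g))"
      by (rule cINF_greatest) (use Q lb in auto)
  qed
qed

definition freq :: "nat \<Rightarrow> (nat \<Rightarrow> 'a) \<Rightarrow> 'a set \<Rightarrow> real" where
  "freq n z C = (\<Sum>i<n. indicat_real C (z i)) / real n"

lemma freq_nonneg: "0 \<le> freq n z C"
  by (auto simp: freq_def intro!: divide_nonneg_nonneg sum_nonneg)

lemma freq_le_1: "freq n z C \<le> 1"
proof (cases "n = 0")
  case False
  have "(\<Sum>i<n. indicat_real C (z i)) \<le> (\<Sum>i<n. 1)"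
    by (intro sum_mono) (simp add: indicator_def)
  then show ?thesis using False by (simp add: freq_def)
qed (simp add: freq_def)

text \<open>The argument for \<open>P\<close> with weights instead of densities: the optimal weights depend only on
  whether the observation is misclassified.\<close>
lemma emp_trimmed_risk_eq_trim:
  assumes n: "n > 0" and \<alpha>: "0 \<le> \<alpha>" "\<alpha> < 1"
  shows "emp_trimmed_risk n z \<alpha> g = trim \<alpha> (freq n z (error_set g))"
proof -
  define e where "e i = indicat_real (error_set g) (z i)" for i
  define p where "p = freq n z (error_set g)"
  have p: "0 \<le> p" "p \<le> 1" by (simp_all add: p_def freq_nonneg freq_le_1)
  have se: "(\<Sum>i<n. e i) = n * p" using n by (simp add: p_def freq_def e_def)
  have e01: "e i = 0 \<or> e i = 1" for i by (auto simp: e_def indicator_def)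
  let ?w = "\<lambda>w. \<Sum>i<n. w i * e i"
  have lb: "trim \<alpha> p \<le> ?w w" if "w \<in> trim_weights n \<alpha>" for w
  proof -
    have w: "\<And>i. i < n \<Longrightarrow> 0 \<le> w i" "\<And>i. i < n \<Longrightarrow> w i \<le> 1 / (n * (1 - \<alpha>))" "(\<Sum>i<n. w i) = 1"
      using that by (auto simp: trim_weights_def)
    have "0 \<le> ?w w" using w by (intro sum_nonneg mult_nonneg_nonneg) (auto simp: e_def)
    moreover have "1 - ?w w = (\<Sum>i<n. w i * (1 - e i))"
      by (simp add: right_diff_distrib sum_subtractf w)
    moreover have "\<dots> \<le> (\<Sum>i<n. 1 / (n * (1 - \<alpha>)) * (1 - e i))"
      using w by (intro sum_mono mult_right_mono) (auto simp: e_def indicator_def)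
    moreover have "\<dots> = 1 / (n * (1 - \<alpha>)) * (\<Sum>i<n. 1 - e i)"
      by (rule sum_distrib_left[symmetric])
    moreover have "\<dots> = (1 - p) / (1 - \<alpha>)"
      using n \<alpha> by (simp add: sum_subtractf se field_simps)
    moreover have "1 - (1 - p) / (1 - \<alpha>) = (p - \<alpha>) / (1 - \<alpha>)"
      using \<alpha> by (simp add: field_simps)
    ultimately show ?thesis unfolding trim_def by linarith
  qed
  have ex: "\<exists>w\<in>trim_weights n \<alpha>. ?w w = trim \<alpha> p"
  proof -
    define u v where "u = (if p \<le> \<alpha> then 0 else trim \<alpha> p / (n * p))"
      and "v = (if p \<le> \<alpha> then 1 / (n * (1 - p)) else 1 / (n * (1 - \<alpha>)))"
    define w where "w i = u * e i + v * (1 - e i)" for i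
    have u1: "n * p * u = trim \<alpha> p"
      using n p \<alpha> by (auto simp: u_def trim_def max_def field_simps)
    have v1: "n * (1 - p) * v = 1 - trim \<alpha> p"
      using n p \<alpha> by (auto simp: v_def trim_def max_def divide_simps)
    have uv: "0 \<le> u" "0 \<le> v"
      using p \<alpha> by (auto simp: u_def v_def trim_nonneg)
    have vle: "v \<le> 1 / (n * (1 - \<alpha>))"
      using n p \<alpha> by (auto simp: v_def intro!: frac_le)
    have ule: "u \<le> 1 / (n * (1 - \<alpha>))"
    proof (cases "p \<le> \<alpha>")
      case False
      then have p0: "0 < p" using \<alpha> by simp
      have "trim \<alpha> p \<le> p / (1 - \<alpha>)"
        using False \<alpha> by (auto simp: trim_def max_def divide_right_mono)
      then have "u \<le> p / (1 - \<alpha>) / (n * p)"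
        using False p0 by (simp add: u_def divide_right_mono del: divide_divide_eq_left)
      also have "\<dots> = 1 / (n * (1 - \<alpha>))" using p0 by simp
      finally show ?thesis .
    qed (use \<alpha> in \<open>simp add: u_def\<close>)
    have "0 \<le> w i \<and> w i \<le> 1 / (n * (1 - \<alpha>))" for i
      using e01[of i] uv ule vle by (auto simp: w_def)
    moreover have "(\<Sum>i<n. w i) = n * p * u + n * (1 - p) * v"
      by (simp add: w_def sum.distrib sum_subtractf se algebra_simps flip: sum_distrib_left)
    ultimately have "w \<in> trim_weights n \<alpha>"
      by (simp add: trim_weights_def u1 v1)
    moreover have "?w w = trim \<alpha> p"
    proof -
      have "w i * e i = u * e i" for i using e01[of i] by (auto simp: w_def)
      then have "?w w = (\<Sum>i<n. u * e i)" by (simp only:)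
      then show ?thesis using u1 by (simp add: se mult_ac flip: sum_distrib_left)
    qed
    ultimately show ?thesis by blast
  qed
  then obtain w where w: "w \<in> trim_weights n \<alpha>" "?w w = trim \<alpha> p" by blast
  show ?thesis
    unfolding emp_trimmed_risk_def e_def[symmetric] p_def[symmetric]
  proof (rule antisym)
    show "(INF w\<in>trim_weights n \<alpha>. ?w w) \<le> trim \<alpha> p"
      unfolding w(2)[symmetric] by (rule cINF_lower) (use w lb in \<open>auto intro: bdd_belowI2[where m = "trim \<alpha> p"]\<close>)
    show "trim \<alpha> p \<le> (INF w\<in>trim_weights n \<alpha>. ?w w)"
      by (rule cINF_greatest) (use w lb in auto)
  qed
qed

lemma INF_trim:
  assumes \<alpha>: "\<alpha> < 1" and h: "h \<in> G" "\<And>g. g \<in> G \<Longrightarrow> f h \<le> f g"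
  shows "(INF g\<in>G. trim \<alpha> (f g)) = trim \<alpha> (INF g\<in>G. f g)"
proof -
  have "(INF g\<in>G. f g) = f h"
    using h by (intro antisym cINF_lower cINF_greatest) (auto intro: bdd_belowI2[where m = "f h"])
  moreover have "(INF g\<in>G. trim \<alpha> (f g)) = trim \<alpha> (f h)"
    using h trim_mono[OF \<alpha>]
    by (intro antisym cINF_lower cINF_greatest) (auto intro: bdd_belowI2[where m = "trim \<alpha> (f h)"])
  ultimately show ?thesis by simp
qed

section \<open>Exchanging the sample with ghosts\<close>

text \<open>Hoeffding's lemma for a uniformly drawn entry of a finite list of numbers from the unit
  interval.\<close>
lemma uniform_mgf_le:
  fixes b :: "nat \<Rightarrow> real"
  assumes K: "K > 0" and b: "\<And>l. l < K \<Longrightarrow> 0 \<le> b l \<and> b l \<le> 1" and s: "s > 0"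
  shows "(\<Sum>l<K. exp (s * ((\<Sum>j<K. b j) / K - b l))) / K \<le> exp (s\<^sup>2 / 8)"
proof -
  define U where "U = measure_pmf (pmf_of_set {..<K})"
  have ne: "{..<K} \<noteq> {}" using K by auto
  define a where "a = (\<Sum>j<K. b j) / K"
  define f where "f l = (if l < K then a - b l else 0)" for l
  interpret prob_space U unfolding U_def by (rule measure_pmf.prob_space_axioms)
  interpret interval_bounded_random_variable U f "a - 1" a
  proof
    have "0 \<le> a" "a \<le> 1"
      using b sum_mono[of "{..<K}" b "\<lambda>_. 1"] K by (auto simp: a_def intro!: sum_nonneg divide_nonneg_nonneg)
    then show "AE x in U. f x \<in> {a - 1..a}"
      using b by (intro AE_I2) (auto simp: f_def)
  qed (simp add: U_def)
  have E: "expectation g = (\<Sum>l<K. g l) / K" for g :: "nat \<Rightarrow> real"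
    unfolding U_def using ne by (subst integral_pmf_of_set) auto
  have "expectation f = 0"
    unfolding E using K by (simp add: f_def sum_subtractf a_def)
  then have *: "nn_integral U (\<lambda>x. exp (s * f x)) \<le> ennreal (exp (s\<^sup>2 * (a - (a - 1))\<^sup>2 / 8))"
    by (intro Hoeffdings_lemma_nn_integral_0 s)
  have "nn_integral U (\<lambda>x. exp (s * f x)) = ennreal (expectation (\<lambda>x. exp (s * f x)))"
    unfolding U_def using ne
    by (intro nn_integral_eq_integral integrable_measure_pmf_finite) auto
  with * have "expectation (\<lambda>x. exp (s * f x)) \<le> exp (s\<^sup>2 / 8)" by simp
  then show ?thesis unfolding E by (simp add: f_def a_def)
qed

text \<open>The indices below \<open>n * K\<close> are arranged in \<open>n\<close> blocks of \<open>K\<close>: index \<open>i + n * l\<close> is the member \<open>l\<close>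
  of block \<open>i\<close>. The first \<open>n\<close> indices, the members 0, are the sample, and all others are
  ghosts. The permutation exchanges, in every block \<open>i\<close>, the sample point with the member
  \<open>j i\<close>.\<close>
definition swap_layer :: "nat \<Rightarrow> (nat \<Rightarrow> nat) \<Rightarrow> nat \<Rightarrow> nat" where
  "swap_layer n j k = k mod n + n * Transposition.transpose 0 (j (k mod n)) (k div n)"

lemma transpose_less: "0 < K \<Longrightarrow> j < K \<Longrightarrow> l < K \<Longrightarrow> Transposition.transpose 0 j l < (K::nat)"
  by (simp add: Transposition.transpose_def)

lemma swap_layer_block:
  "i < n \<Longrightarrow> swap_layer n j (i + n * l) = i + n * Transposition.transpose 0 (j i) l"
  by (simp add: swap_layer_def)

lemma block_less: "i < n \<Longrightarrow> l < K \<Longrightarrow> i + n * l < n * (K::nat)"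
proof -
  assume "i < n" "l < K"
  then have "i + n * l < n * Suc l" by simp
  also have "\<dots> \<le> n * K" using \<open>l < K\<close> by (intro mult_le_mono2) simp
  finally show ?thesis .
qed

lemma swap_layer_less:
  assumes j: "\<And>i. i < n \<Longrightarrow> j i < K" and k: "k < n * K"
  shows "swap_layer n j k < n * K"
proof -
  have n: "n > 0" "K > 0" using k by (auto intro: gr0I)
  have "k div n < K" using k n by (simp add: less_mult_imp_div_less mult.commute)
  then show ?thesis unfolding swap_layer_def
    using n j by (intro block_less transpose_less) auto
qed

lemma swap_layer_involution:
  assumes "n > 0"
  shows "swap_layer n j (swap_layer n j k) = k"
proof -
  have "swap_layer n j k = k mod n + n * Transposition.transpose 0 (j (k mod n)) (k div n)"
    by (simp add: swap_layer_def)
  then have "swap_layer n j (swap_layer n j k) = k mod n + n * (k div n)"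
    using assms by (simp add: swap_layer_block)
  then show ?thesis by simp
qed

lemma sum_blocks:
  fixes f :: "nat \<Rightarrow> 'b::comm_monoid_add"
  shows "(\<Sum>k<n * K. f k) = (\<Sum>i<n. \<Sum>l<K. f (i + n * l))"
proof -
  have "(\<Sum>k<n * K. f k) = (\<Sum>l<K. sum f {l * n..<l * n + n})"
    by (simp add: sum.nat_group mult.commute)
  also have "\<dots> = (\<Sum>l<K. \<Sum>i<n. f (i + n * l))"
  proof (rule sum.cong[OF refl])
    fix l
    show "sum f {l * n..<l * n + n} = (\<Sum>i<n. f (i + n * l))"
      using sum.shift_bounds_nat_ivl[of f 0 "l * n" n]
      by (simp add: lessThan_atLeast0 mult.commute add.commute)
  qed
  also have "\<dots> = (\<Sum>i<n. \<Sum>l<K. f (i + n * l))" by (rule sum.swap)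
  finally show ?thesis .
qed

lemma sum_swap_layer:
  fixes f :: "nat \<Rightarrow> 'b::comm_monoid_add"
  assumes j: "\<And>i. i < n \<Longrightarrow> j i < K" and n: "n > 0"
  shows "(\<Sum>k<n * K. f (swap_layer n j k)) = (\<Sum>k<n * K. f k)"
  by (rule sum.reindex_bij_witness[where i = "swap_layer n j" and j = "swap_layer n j"])
    (use swap_layer_less[OF j] swap_layer_involution[OF n] in auto)

text \<open>Ghost frequency minus sample frequency of the trace \<open>B\<close>; there are \<open>n * (K - 1)\<close> ghosts.\<close>
definition gap :: "nat \<Rightarrow> nat \<Rightarrow> nat set \<Rightarrow> real" where
  "gap n K B = (\<Sum>k=n..<n * K. indicat_real B k) / (real n * (real K - 1))
      - (\<Sum>i<n. indicat_real B i) / real n"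

text \<open>Expressed through the mean over all points, which the block permutations leave unchanged.\<close>
lemma gap_eq:
  assumes n: "n > 0" and K: "K > 1"
  shows "gap n K B = real K / (real K - 1) *
    ((\<Sum>k<n * K. indicat_real B k) / (real n * K) - (\<Sum>i<n. indicat_real B i) / n)"
proof -
  define T where "T = (\<Sum>k<n * K. indicat_real B k)"
  define S where "S = (\<Sum>i<n. indicat_real B i)"
  have "{..<n * K} = {..<n} \<union> {n..<n * K}"
    using K by (intro ivl_disj_un_one(2)[symmetric]) simp
  then have TS: "T = S + (\<Sum>k=n..<n * K. indicat_real B k)"
    unfolding T_def S_def by (simp add: sum.union_disjoint[symmetric] ivl_disj_int)
  have "gap n K B = (T - S) / (real n * (real K - 1)) - S / n"
    by (simp add: gap_def TS) (simp add: S_def)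
  also have "\<dots> = real K / (real K - 1) * (T / (real n * real K) - S / n)"
    using n K by (simp add: divide_simps) (simp add: algebra_simps)
  finally show ?thesis by (simp only: T_def S_def)
qed

text \<open>Under independent uniform exchanges the gap is a sum of independent terms, one for each block:
  the average of exponentials factorizes and Hoeffding's lemma applies to every factor.\<close>
lemma average_gap_swaps_le:
  assumes n: "n > 0" and K: "K > 1" and lam: "lam > 0"
  shows "(\<Sum>j\<in>PiE {..<n} (\<lambda>_. {..<K}). exp (lam * gap n K {k. k < n * K \<and> swap_layer n j k \<in> B}))
     \<le> real K ^ n * exp (lam\<^sup>2 * (real K / (real K - 1))\<^sup>2 / (8 * n))"
proof -
  define c where "c = real K / (real K - 1)"
  have c: "c > 0" using K by (simp add: c_def)
  define m where "m i = (\<Sum>l<K. indicat_real B (i + n * l)) / K" for i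
  define s where "s = lam * c / n"
  have s: "s > 0" using lam c n by (simp add: s_def)
  have gap: "lam * gap n K {k. k < n * K \<and> swap_layer n j k \<in> B}
      = (\<Sum>i<n. s * (m i - indicat_real B (i + n * j i)))"
    if j: "j \<in> PiE {..<n} (\<lambda>_. {..<K})" for j
  proof -
    let ?B = "{k. k < n * K \<and> swap_layer n j k \<in> B}"
    have j': "\<And>i. i < n \<Longrightarrow> j i < K" using j by auto
    have "(\<Sum>k<n * K. indicat_real ?B k) = (\<Sum>k<n * K. indicat_real B (swap_layer n j k))"
      by (intro sum.cong) (auto simp: indicator_def)
    also have "\<dots> = (\<Sum>k<n * K. indicat_real B k)" by (rule sum_swap_layer[OF j' n])
    also have "\<dots> = K * (\<Sum>i<n. m i)"
      using K by (simp add: sum_blocks m_def flip: sum_divide_distrib)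
    finally have 1: "(\<Sum>k<n * K. indicat_real ?B k) = K * (\<Sum>i<n. m i)" .
    have 2: "(\<Sum>i<n. indicat_real ?B i) = (\<Sum>i<n. indicat_real B (i + n * j i))"
    proof (intro sum.cong refl)
      fix i assume i: "i \<in> {..<n}"
      then have "i < n * K" using K block_less[of i n 0 K] by simp
      moreover have "swap_layer n j i = i + n * j i"
        using i by (simp add: swap_layer_def)
      ultimately show "indicat_real ?B i = indicat_real B (i + n * j i)"
        by (simp add: indicator_def)
    qed
    have "gap n K ?B = c * ((\<Sum>i<n. m i) / n - (\<Sum>i<n. indicat_real B (i + n * j i)) / n)"
      unfolding gap_eq[OF n K] 1 2 c_def using K by (simp add: mult.commute)
    then show ?thesis
      by (simp add: s_def sum_subtractf diff_divide_distrib right_diff_distrib mult.assoc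
          flip: sum_distrib_left sum_divide_distrib)
  qed
  have "(\<Sum>j\<in>PiE {..<n} (\<lambda>_. {..<K}). exp (lam * gap n K {k. k < n * K \<and> swap_layer n j k \<in> B}))
      = (\<Sum>j\<in>PiE {..<n} (\<lambda>_. {..<K}). \<Prod>i<n. exp (s * (m i - indicat_real B (i + n * j i))))"
    by (intro sum.cong refl) (simp add: gap exp_sum)
  also have "\<dots> = (\<Prod>i<n. \<Sum>l<K. exp (s * (m i - indicat_real B (i + n * l))))"
    by (rule prod_sum_PiE[symmetric]) auto
  also have "\<dots> \<le> (\<Prod>i<n. K * exp (s\<^sup>2 / 8))"
  proof (intro prod_mono conjI sum_nonneg)
    fix i
    have "(\<Sum>l<K. exp (s * (m i - indicat_real B (i + n * l)))) / K \<le> exp (s\<^sup>2 / 8)"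
      unfolding m_def by (rule uniform_mgf_le) (use K s in auto)
    then show "(\<Sum>l<K. exp (s * (m i - indicat_real B (i + n * l)))) \<le> K * exp (s\<^sup>2 / 8)"
      using K by (simp add: field_simps)
  qed auto
  also have "\<dots> = real K ^ n * exp (n * (s\<^sup>2 / 8))"
    by (simp only: prod_constant card_lessThan power_mult_distrib exp_of_nat_mult)
  also have "n * (s\<^sup>2 / 8) = lam\<^sup>2 * c\<^sup>2 / (8 * n)"
    using n by (simp add: s_def power_divide power_mult_distrib power2_eq_square mult_ac)
  finally show ?thesis by (simp only: c_def)
qed

section \<open>Deviations of the smallest frequency in a class\<close>

definition min_freq :: "'a set set \<Rightarrow> nat \<Rightarrow> (nat \<Rightarrow> 'a) \<Rightarrow> real" where
  "min_freq \<C> n z = (INF C\<in>\<C>. freq n z C)"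

lemma freq_eq_trace: "freq n z C = (\<Sum>i<n. indicat_real {k. k < n \<and> z k \<in> C} i) / n"
  unfolding freq_def by (intro arg_cong2[where f = "(/)"] sum.cong refl) (auto simp: indicator_def)

text \<open>Only finitely many frequencies occur, since they are determined by the traces.\<close>
lemma min_freq_attained:
  assumes "\<C> \<noteq> {}"
  obtains C where "C \<in> \<C>" and "freq n z C = min_freq \<C> n z"
proof -
  have "freq n z ` \<C> = (\<lambda>B. (\<Sum>i<n. indicat_real B i) / n) ` traces \<C> n z"
    unfolding traces_def image_image by (intro image_cong refl freq_eq_trace)
  then have "finite (freq n z ` \<C>)" by simp
  then have "min_freq \<C> n z \<in> freq n z ` \<C>"
    unfolding min_freq_def using assms by (subst cInf_eq_Min) auto
  then show ?thesis using that by auto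
qed

lemma min_freq_le: "C \<in> \<C> \<Longrightarrow> min_freq \<C> n z \<le> freq n z C"
  unfolding min_freq_def by (rule cINF_lower) (auto intro: bdd_belowI2[where m = 0] freq_nonneg)

lemma min_freq_nonneg: "\<C> \<noteq> {} \<Longrightarrow> 0 \<le> min_freq \<C> n z"
  unfolding min_freq_def by (rule cINF_greatest) (auto intro: freq_nonneg)

text \<open>The last assumption makes every quantity that depends on the class only through its traces
  measurable, also for an uncountable class.\<close>
locale vc_event_class = prob_space P for P :: "'a measure" +
  fixes \<C> :: "'a set set" and V :: nat
  assumes events: "C \<in> \<C> \<Longrightarrow> C \<in> sets P"
    and nonempty: "\<C> \<noteq> {}"
    and shattered_card_le: "finite A \<Longrightarrow> shatters \<C> A \<Longrightarrow> card A \<le> V"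
    and trace_events: "{w \<in> space (PiM {..<m} (\<lambda>_. P)). B \<in> traces \<C> m w} \<in> sets (PiM {..<m} (\<lambda>_. P))"
begin

lemma prob_space_power: "prob_space (PiM I (\<lambda>_. P))"
  by (intro prob_space_PiM) unfold_locales

lemma measurable_min_freq [measurable]:
  "min_freq \<C> n \<in> borel_measurable (PiM {..<n} (\<lambda>_. P))"
proof (subst borel_measurable_iff_le, intro allI)
  fix a :: real
  let ?f = "\<lambda>B. (\<Sum>i<n. indicat_real B i) / n"
  have eq: "min_freq \<C> n z \<le> a \<longleftrightarrow> (\<exists>B\<in>{B. B \<subseteq> {..<n} \<and> ?f B \<le> a}. B \<in> traces \<C> n z)" for z
  proof
    assume le: "min_freq \<C> n z \<le> a"
    obtain C where C: "C \<in> \<C>" "freq n z C = min_freq \<C> n z"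
      using min_freq_attained[OF nonempty] .
    let ?B = "{k. k < n \<and> z k \<in> C}"
    have "?B \<in> traces \<C> n z" using C by (auto simp: traces_def)
    moreover have "?f ?B \<le> a" using le C(2) by (simp add: freq_eq_trace)
    ultimately show "\<exists>B\<in>{B. B \<subseteq> {..<n} \<and> ?f B \<le> a}. B \<in> traces \<C> n z"
      by (intro bexI[of _ ?B]) auto
  next
    assume "\<exists>B\<in>{B. B \<subseteq> {..<n} \<and> ?f B \<le> a}. B \<in> traces \<C> n z"
    then obtain C where C: "C \<in> \<C>" "?f {k. k < n \<and> z k \<in> C} \<le> a"
      by (auto simp: traces_def)
    then have "freq n z C \<le> a" by (simp only: freq_eq_trace)
    then show "min_freq \<C> n z \<le> a" using min_freq_le[OF C(1), of n z] by linarith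
  qed
  have "{w \<in> space (PiM {..<n} (\<lambda>_. P)). min_freq \<C> n w \<le> a} =
      (\<Union>B\<in>{B. B \<subseteq> {..<n} \<and> ?f B \<le> a}. {w \<in> space (PiM {..<n} (\<lambda>_. P)). B \<in> traces \<C> n w})"
    using eq by blast
  also have "\<dots> \<in> sets (PiM {..<n} (\<lambda>_. P))"
    by (intro sets.finite_UN trace_events) auto
  finally show "{w \<in> space (PiM {..<n} (\<lambda>_. P)). min_freq \<C> n w \<le> a} \<in> sets (PiM {..<n} (\<lambda>_. P))" .
qed

text \<open>Summing over the traces bounds the exponential of the supremum of the gap over the class.\<close>
definition gap_mgf :: "nat \<Rightarrow> nat \<Rightarrow> real \<Rightarrow> (nat \<Rightarrow> 'a) \<Rightarrow> ennreal" where
  "gap_mgf n K lam w = (\<Sum>B\<in>traces \<C> (n * K) w. ennreal (exp (lam * gap n K B)))"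

lemma measurable_gap_mgf [measurable]:
  "gap_mgf n K lam \<in> borel_measurable (PiM {..<n * K} (\<lambda>_. P))"
proof -
  let ?M = "PiM {..<n * K} (\<lambda>_. P)"
  let ?T = "\<lambda>B. {w \<in> space ?M. B \<in> traces \<C> (n * K) w}"
  have "gap_mgf n K lam w =
      (\<Sum>B\<in>Pow {..<n * K}. ennreal (exp (lam * gap n K B)) * indicator (?T B) w)"
    if w: "w \<in> space ?M" for w
  proof -
    have "gap_mgf n K lam w =
        (\<Sum>B\<in>traces \<C> (n * K) w. ennreal (exp (lam * gap n K B)) * indicator (?T B) w)"
      unfolding gap_mgf_def using w by (intro sum.cong) auto
    also have "\<dots> = (\<Sum>B\<in>Pow {..<n * K}. ennreal (exp (lam * gap n K B)) * indicator (?T B) w)"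
      by (intro sum.mono_neutral_left) (auto simp: traces_def)
    finally show ?thesis .
  qed
  moreover have "(\<lambda>w. \<Sum>B\<in>Pow {..<n * K}. ennreal (exp (lam * gap n K B)) * indicator (?T B) w)
      \<in> borel_measurable ?M"
    by (intro borel_measurable_sum borel_measurable_times_ennreal borel_measurable_const
        borel_measurable_indicator trace_events)
  ultimately show ?thesis by (subst measurable_cong) auto
qed

text \<open>Permuting the observations permutes the traces.\<close>
lemma gap_mgf_swap:
  assumes n: "n > 0" and j: "\<And>i. i < n \<Longrightarrow> j i < K"
  shows "gap_mgf n K lam (\<lambda>k\<in>{..<n * K}. w (swap_layer n j k)) =
    (\<Sum>B\<in>traces \<C> (n * K) w.
       ennreal (exp (lam * gap n K {k. k < n * K \<and> swap_layer n j k \<in> B})))"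
proof -
  let ?s = "swap_layer n j"
  let ?r = "\<lambda>B. {k. k < n * K \<and> ?s k \<in> B}"
  have less: "k < n * K \<Longrightarrow> ?s k < n * K" for k by (rule swap_layer_less[OF j])
  have "traces \<C> (n * K) (\<lambda>k\<in>{..<n * K}. w (?s k)) = ?r ` traces \<C> (n * K) w"
    unfolding traces_def image_image by (intro image_cong) (auto simp: less)
  moreover have "inj_on ?r (traces \<C> (n * K) w)"
  proof (rule inj_on_inverseI[where g = ?r])
    fix B assume "B \<in> traces \<C> (n * K) w"
    then have "B \<subseteq> {..<n * K}" by (auto simp: traces_def)
    then show "?r (?r B) = B" using less swap_layer_involution[OF n] by auto
  qed
  ultimately show ?thesis unfolding gap_mgf_def by (simp add: sum.reindex)
qed

text \<open>The permuted points have the same distribution as the original ones, so the integral may be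
  averaged over all exchanges before it is evaluated; the exchanges act on a fixed set of traces, of
  which there are polynomially many.\<close>
lemma nn_integral_gap_mgf_le:
  assumes n: "n > 0" and K: "K > 1" and lam: "lam > 0"
  shows "(\<integral>\<^sup>+w. gap_mgf n K lam w \<partial>PiM {..<n * K} (\<lambda>_. P))
    \<le> ennreal (real (n * K + 1) ^ V * exp (lam\<^sup>2 * (real K / (real K - 1))\<^sup>2 / (8 * n)))"
proof -
  let ?M = "PiM {..<n * K} (\<lambda>_. P)"
  let ?J = "PiE {..<n} (\<lambda>_. {..<K})"
  let ?e = "exp (lam\<^sup>2 * (real K / (real K - 1))\<^sup>2 / (8 * n))"
  let ?r = "\<lambda>j w. \<lambda>k\<in>{..<n * K}. w (swap_layer n j k)"
  interpret M: prob_space ?M by (rule prob_space_power)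
  have less: "swap_layer n j k < n * K" if "j \<in> ?J" "k < n * K" for j k
    by (rule swap_layer_less) (use that in auto)
  have meas: "?r j \<in> measurable ?M ?M" if "j \<in> ?J" for j
    using less[OF that] by (intro measurable_restrict measurable_component_singleton) auto
  have inv: "(\<integral>\<^sup>+w. gap_mgf n K lam (?r j w) \<partial>?M) = (\<integral>\<^sup>+w. gap_mgf n K lam w \<partial>?M)" if j: "j \<in> ?J" for j
  proof -
    have "distr ?M ?M (?r j) = ?M"
    proof (rule distr_PiM_reindex)
      show "inj_on (swap_layer n j) {..<n * K}"
        by (rule inj_on_inverseI[where g = "swap_layer n j"]) (rule swap_layer_involution[OF n])
      show "swap_layer n j \<in> {..<n * K} \<rightarrow> {..<n * K}" using less[OF j] by auto
    qed unfold_locales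
    then have "(\<integral>\<^sup>+w. gap_mgf n K lam w \<partial>?M) = (\<integral>\<^sup>+w. gap_mgf n K lam w \<partial>distr ?M ?M (?r j))" by simp
    also have "\<dots> = (\<integral>\<^sup>+w. gap_mgf n K lam (?r j w) \<partial>?M)"
      by (intro nn_integral_distr meas[OF j]) (simp add: measurable_gap_mgf)
    finally show ?thesis by simp
  qed
  have pw: "(\<Sum>j\<in>?J. gap_mgf n K lam (?r j w))
      \<le> ennreal (real (n * K + 1) ^ V * (real K ^ n * ?e))" for w
  proof -
    have "(\<Sum>j\<in>?J. gap_mgf n K lam (?r j w)) = (\<Sum>j\<in>?J. \<Sum>B\<in>traces \<C> (n * K) w.
        ennreal (exp (lam * gap n K {k. k < n * K \<and> swap_layer n j k \<in> B})))"
      by (intro sum.cong refl gap_mgf_swap n) auto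
    also have "\<dots> = (\<Sum>B\<in>traces \<C> (n * K) w. \<Sum>j\<in>?J.
        ennreal (exp (lam * gap n K {k. k < n * K \<and> swap_layer n j k \<in> B})))"
      by (rule sum.swap)
    also have "\<dots> = ennreal (\<Sum>B\<in>traces \<C> (n * K) w. \<Sum>j\<in>?J.
        exp (lam * gap n K {k. k < n * K \<and> swap_layer n j k \<in> B}))"
      by (simp add: sum_nonneg)
    also have "\<dots> \<le> ennreal (\<Sum>B\<in>traces \<C> (n * K) w. real K ^ n * ?e)"
      by (intro ennreal_leI sum_mono average_gap_swaps_le n K lam)
    also have "\<dots> \<le> ennreal (real (n * K + 1) ^ V * (real K ^ n * ?e))"
    proof -
      have "real (card (traces \<C> (n * K) w)) \<le> real ((n * K + 1) ^ V)"
        using card_traces_le[OF shattered_card_le] of_nat_le_iff by blast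
      then show ?thesis
        by (intro ennreal_leI) (simp add: mult_right_mono)
    qed
    finally show ?thesis .
  qed
  have "ennreal (real K ^ n) * (\<integral>\<^sup>+w. gap_mgf n K lam w \<partial>?M)
      = (\<Sum>j\<in>?J. \<integral>\<^sup>+w. gap_mgf n K lam (?r j w) \<partial>?M)"
    by (simp add: inv card_PiE ennreal_of_nat_eq_real_of_nat)
  also have "\<dots> = (\<integral>\<^sup>+w. (\<Sum>j\<in>?J. gap_mgf n K lam (?r j w)) \<partial>?M)"
    by (intro nn_integral_sum[symmetric] measurable_compose[OF meas measurable_gap_mgf])
  also have "\<dots> \<le> (\<integral>\<^sup>+w. ennreal (real (n * K + 1) ^ V * (real K ^ n * ?e)) \<partial>?M)"
    by (intro nn_integral_mono pw)
  also have "\<dots> = ennreal (real K ^ n) * ennreal (real (n * K + 1) ^ V * ?e)"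
    by (simp only: nn_integral_const M.emeasure_space_1 mult_1_right)
      (simp add: ennreal_mult[symmetric] mult_ac)
  finally show ?thesis
    using K by (subst (asm) ennreal_mult_le_mult_iff) auto
qed

text \<open>For the event \<open>C\<close> of smallest frequency in the sample, the ghost frequency averages to the
  probability of \<open>C\<close>, and Jensen's inequality for the exponential function applies. The choice of
  \<open>C\<close> is made separately for each \<open>z\<close>, before the integral over the ghosts, so no measurable
  selection is involved.\<close>
lemma exp_deviation_le_ghost_average:
  assumes n: "n > 0" and K: "K > 1" and lam: "lam > 0"
    and p: "\<And>C. C \<in> \<C> \<Longrightarrow> p \<le> prob C"
    and z: "z \<in> space (PiM {..<n} (\<lambda>_. P))"
  shows "ennreal (exp (lam * (p - min_freq \<C> n z)))
    \<le> (\<integral>\<^sup>+z'. gap_mgf n K lam (merge {..<n} {n..<n * K} (z, z')) \<partial>PiM {n..<n * K} (\<lambda>_. P))"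
proof -
  let ?G = "PiM {n..<n * K} (\<lambda>_. P)"
  interpret G: prob_space ?G by (rule prob_space_power)
  obtain C where C: "C \<in> \<C>" "freq n z C = min_freq \<C> n z"
    using min_freq_attained[OF nonempty] .
  have Cm[measurable]: "C \<in> sets P" using events C by auto
  define q where "q = prob C"
  define h where "h z' = (\<Sum>k=n..<n * K. indicat_real C (z' k)) / (real n * (real K - 1))" for z'
  define f where "f = min_freq \<C> n z"
  have cardI: "real (card {n..<n * K}) = real n * (real K - 1)" "real n * (real K - 1) > 0"
    using n K by (auto simp: of_nat_diff algebra_simps)
  have int1: "integrable ?G (\<lambda>z'. indicat_real C (z' k))" if "k \<in> {n..<n * K}" for k
    using that by (intro G.integrable_const_bound[where B = 1]) auto
  have ind: "(\<integral>z'. indicat_real C (z' k) \<partial>?G) = q" if k: "k \<in> {n..<n * K}" for k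
  proof -
    have "(\<integral>z'. indicat_real C (z' k) \<partial>?G) = (\<integral>x. indicat_real C x \<partial>distr ?G P (\<lambda>z'. z' k))"
      using k by (intro integral_distr[symmetric]) auto
    also have "distr ?G P (\<lambda>z'. z' k) = P"
      using k by (intro distr_PiM_component) unfold_locales
    finally show ?thesis by (simp add: q_def)
  qed
  have hint: "integrable ?G h" unfolding h_def by (intro integrable_divide Bochner_Integration.integrable_sum int1)
  have Eh: "G.expectation h = q"
  proof -
    have "G.expectation h = (\<Sum>k=n..<n * K. \<integral>z'. indicat_real C (z' k) \<partial>?G) / (real n * (real K - 1))"
      unfolding h_def by (simp add: Bochner_Integration.integral_sum int1)
    also have "(\<Sum>k=n..<n * K. \<integral>z'. indicat_real C (z' k) \<partial>?G) = real (card {n..<n * K}) * q"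
      by (simp add: ind)
    also have "\<dots> / (real n * (real K - 1)) = q"
      unfolding cardI(1) by (rule nonzero_mult_div_cancel_left) (use cardI(2) in linarith)
    finally show ?thesis .
  qed
  \<comment> \<open>the tangent of the exponential function at the mean, which proves Jensen's inequality\<close>
  let ?j = "\<lambda>z'. exp (lam * (q - f)) * (1 + lam * (h z' - q))"
  have jint: "integrable ?G ?j" using hint by simp
  have "exp (lam * (p - f)) \<le> exp (lam * (q - f))"
    using p[OF C(1)] lam by (simp add: q_def)
  also have "\<dots> = G.expectation ?j"
    using hint by (simp add: Eh G.prob_space)
  finally have "ennreal (exp (lam * (p - f))) \<le> ennreal (G.expectation ?j)" by (rule ennreal_leI)
  also have "\<dots> \<le> ennreal (G.expectation (\<lambda>z'. max 0 (?j z')))"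
    using jint by (intro ennreal_leI integral_mono) auto
  also have "\<dots> = (\<integral>\<^sup>+z'. ennreal (max 0 (?j z')) \<partial>?G)"
    using jint by (intro nn_integral_eq_integral[symmetric]) auto
  also have "\<dots> \<le> (\<integral>\<^sup>+z'. gap_mgf n K lam (merge {..<n} {n..<n * K} (z, z')) \<partial>?G)"
  proof (rule nn_integral_mono)
    fix z' assume "z' \<in> space ?G"
    let ?w = "merge {..<n} {n..<n * K} (z, z')"
    let ?B = "{k. k < n * K \<and> ?w k \<in> C}"
    have B: "?B \<in> traces \<C> (n * K) ?w" using C by (auto simp: traces_def)
    have nK: "i < n \<Longrightarrow> i < n * K" for i using K by (cases K) auto
    have gapB: "gap n K ?B = h z' - f"
    proof -
      have "(\<Sum>k=n..<n * K. indicat_real ?B k) = (\<Sum>k=n..<n * K. indicat_real C (z' k))"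
        by (intro sum.cong refl) (auto simp: indicator_def merge_def)
      moreover have "(\<Sum>i<n. indicat_real ?B i) = (\<Sum>i<n. indicat_real C (z i))"
        by (intro sum.cong refl) (auto simp: indicator_def merge_def nK)
      ultimately show ?thesis by (simp add: gap_def h_def f_def C(2)[symmetric] freq_def)
    qed
    have "?j z' \<le> exp (lam * (q - f)) * exp (lam * (h z' - q))"
      by (intro mult_left_mono exp_ge_add_one_self) auto
    also have "\<dots> = exp (lam * gap n K ?B)"
      unfolding gapB by (simp add: algebra_simps flip: exp_add)
    finally have "ennreal (max 0 (?j z')) \<le> ennreal (exp (lam * gap n K ?B))"
      by (intro ennreal_leI) simp
    also have "\<dots> \<le> gap_mgf n K lam ?w"
      unfolding gap_mgf_def using B by (intro member_le_sum) auto
    finally show "ennreal (max 0 (?j z')) \<le> gap_mgf n K lam ?w" .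
  qed
  finally show ?thesis by (simp add: f_def)
qed

lemma exp_deviation_le:
  assumes n: "n > 0" and K: "K > 1" and lam: "lam > 0"
    and p: "\<And>C. C \<in> \<C> \<Longrightarrow> p \<le> prob C"
  shows "(\<integral>\<^sup>+z. ennreal (exp (lam * (p - min_freq \<C> n z))) \<partial>PiM {..<n} (\<lambda>_. P))
    \<le> ennreal (real (n * K + 1) ^ V * exp (lam\<^sup>2 * (real K / (real K - 1))\<^sup>2 / (8 * n)))"
proof -
  interpret prod: product_sigma_finite "\<lambda>_::nat. P"
    by (intro product_sigma_finite.intro) unfold_locales
  have U: "{..<n} \<union> {n..<n * K} = {..<n * K}"
    using K by (intro ivl_disj_un_one(2)) simp
  have "(\<integral>\<^sup>+z. ennreal (exp (lam * (p - min_freq \<C> n z))) \<partial>PiM {..<n} (\<lambda>_. P))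
    \<le> (\<integral>\<^sup>+z. \<integral>\<^sup>+z'. gap_mgf n K lam (merge {..<n} {n..<n * K} (z, z'))
          \<partial>PiM {n..<n * K} (\<lambda>_. P) \<partial>PiM {..<n} (\<lambda>_. P))"
    by (intro nn_integral_mono exp_deviation_le_ghost_average n K lam p)
  also have "\<dots> = (\<integral>\<^sup>+w. gap_mgf n K lam w \<partial>PiM ({..<n} \<union> {n..<n * K}) (\<lambda>_. P))"
    by (rule prod.product_nn_integral_fold[symmetric]) (auto simp: U measurable_gap_mgf)
  also have "\<dots> \<le> ennreal (real (n * K + 1) ^ V * exp (lam\<^sup>2 * (real K / (real K - 1))\<^sup>2 / (8 * n)))"
    unfolding U by (rule nn_integral_gap_mgf_le[OF n K lam])
  finally show ?thesis .
qed

text \<open>Chernoff's method with \<open>n\<close> ghosts for each observation, that is, blocks of size \<open>n + 1\<close>. If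
  \<open>a < 1\<close>, then dividing \<open>a\<close> by \<open>1 + 1/n\<close> lowers it by less than \<open>1/n\<close>, so the two square roots
  survive the inflation of the variance; if \<open>a \<ge> 1\<close>, there is no excess at all. The cross term in
  the square of the sum is dropped: the squares of the two roots already pay for the number of
  traces and for the factor \<open>exp (- t)\<close>.\<close>
lemma expected_excess_le:
  assumes n: "n > 0" and t: "t \<ge> 0" and p: "\<And>C. C \<in> \<C> \<Longrightarrow> p \<le> prob C"
  defines "a \<equiv> sqrt ((ln (real n) + t) / (2 * real n)) + sqrt ((real V * ln (real n + 1) + ln 2) / real n)
      + 1 / real n"
  shows "(\<integral>\<^sup>+z. ennreal (max 0 (p - min_freq \<C> n z - a)) \<partial>PiM {..<n} (\<lambda>_. P))
    \<le> ennreal (exp (- t) / (4 * real n))"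
proof (cases "a < 1")
  case False
  have "p - min_freq \<C> n z - a \<le> 0" for z
  proof -
    have "p \<le> 1" using nonempty p prob_le_1 by (meson ex_in_conv order_trans)
    then show ?thesis using False min_freq_nonneg[OF nonempty, of n z] by linarith
  qed
  then have "max 0 (p - min_freq \<C> n z - a) = 0" for z
    by (rule max_absorb1)
  then show ?thesis by simp
next
  case True
  define s v where "s = sqrt ((ln (real n) + t) / (2 * real n))"
    and "v = sqrt ((real V * ln (real n + 1) + ln 2) / real n)"
  have a: "a = s + v + 1 / n" by (simp add: a_def s_def v_def)
  have n1: "real n \<ge> 1" using n by simp
  have sv: "s \<ge> 0" "v \<ge> 0" using n1 t by (auto simp: s_def v_def)
  have a0: "1 / n \<le> a" "0 < a" using sv n by (auto simp: a add_nonneg_pos)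
  define c where "c = (real n + 1) / real n"
  have c: "1 < c" "c \<le> 2" using n1 by (auto simp: c_def field_simps)
  \<comment> \<open>the minimizer of \<open>lam\<^sup>2 * c\<^sup>2 / (8 * n) - lam * a\<close>\<close>
  define lam where "lam = 4 * n * a / c\<^sup>2"
  have lam: "lam > 0" using n a0 c by (simp add: lam_def)
  have ac: "s + v \<le> a / c"
  proof -
    have "(s + v) * c = s + v + (s + v) / n" using n by (simp add: c_def field_simps)
    also have "(s + v) / n \<le> 1 / n"
    proof (rule divide_right_mono)
      have "0 \<le> 1 / real n" by simp
      then show "s + v \<le> 1" using True a by linarith
    qed simp
    finally show ?thesis using c by (simp add: a field_simps)
  qed
  have key: "2 * n * (a / c)\<^sup>2 \<ge> 2 * V * ln (n + 1) + 2 * ln 2 + ln n + t"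
  proof -
    have "2 * V * ln (real n + 1) + 2 * ln 2 + ln n + t = 2 * n * (v\<^sup>2 + s\<^sup>2)"
      using n n1 t by (simp add: v_def s_def field_simps)
    also have "\<dots> \<le> 2 * n * (s + v)\<^sup>2"
      using sv by (intro mult_left_mono) (auto simp: power2_sum)
    also have "\<dots> \<le> 2 * n * (a / c)\<^sup>2"
      using ac sv by (intro mult_left_mono power_mono) auto
    finally show ?thesis by (simp add: add.commute)
  qed
  have growth: "real (n * (n + 1) + 1) ^ V \<le> exp (2 * V * ln (n + 1))"
  proof -
    have "real (n * (n + 1) + 1) \<le> (real n + 1)\<^sup>2"
      by (simp add: power2_eq_square algebra_simps)
    then have "real (n * (n + 1) + 1) ^ V \<le> ((real n + 1)\<^sup>2) ^ V"
      by (intro power_mono) auto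
    also have "\<dots> = exp (real (2 * V) * ln (real n + 1))"
      by (simp add: exp_of_nat_mult power_mult[symmetric] del: of_nat_mult)
    finally show ?thesis by (simp add: add.commute)
  qed
  let ?b = "exp (- lam * a) / lam"
  have b: "?b \<ge> 0" using lam by simp
  have "max 0 (p - min_freq \<C> n z - a) \<le> ?b * exp (lam * (p - min_freq \<C> n z))" for z
  proof -
    let ?x = "p - min_freq \<C> n z - a"
    have "lam * ?x \<le> exp (lam * ?x)"
      using exp_ge_add_one_self[of "lam * ?x"] by linarith
    then have "?x \<le> exp (lam * ?x) / lam" using lam by (simp add: field_simps)
    moreover have "0 \<le> exp (lam * ?x) / lam" using lam by simp
    moreover have "exp (lam * ?x) / lam = ?b * exp (lam * (p - min_freq \<C> n z))"
      by (simp add: algebra_simps flip: exp_add)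
    ultimately show ?thesis by linarith
  qed
  then have "(\<integral>\<^sup>+z. ennreal (max 0 (p - min_freq \<C> n z - a)) \<partial>PiM {..<n} (\<lambda>_. P))
    \<le> (\<integral>\<^sup>+z. ennreal ?b * ennreal (exp (lam * (p - min_freq \<C> n z))) \<partial>PiM {..<n} (\<lambda>_. P))"
    using b by (intro nn_integral_mono) (auto simp: ennreal_mult[symmetric] intro!: ennreal_leI)
  also have "\<dots> = ennreal ?b * (\<integral>\<^sup>+z. ennreal (exp (lam * (p - min_freq \<C> n z))) \<partial>PiM {..<n} (\<lambda>_. P))"
    by (rule nn_integral_cmult) measurable
  also have "\<dots> \<le> ennreal ?b * ennreal (real (n * (n + 1) + 1) ^ V *
      exp (lam\<^sup>2 * (real (n + 1) / (real (n + 1) - 1))\<^sup>2 / (8 * n)))"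
    using n by (intro mult_left_mono exp_deviation_le lam p) auto
  also have "\<dots> = ennreal (?b * (real (n * (n + 1) + 1) ^ V * exp (lam\<^sup>2 * c\<^sup>2 / (8 * n))))"
    using b by (subst ennreal_mult[symmetric]) (auto simp: c_def add.commute)
  also have "\<dots> \<le> ennreal (exp (- t) / (4 * real n))"
  proof (rule ennreal_leI)
    define T where "T = 2 * n * (a / c)\<^sup>2"
    have 1: "- lam * a = - (2 * T)" "lam\<^sup>2 * c\<^sup>2 / (8 * n) = T"
      using n c by (simp_all add: T_def lam_def field_simps power2_eq_square)
    have "?b * (real (n * (n + 1) + 1) ^ V * exp (lam\<^sup>2 * c\<^sup>2 / (8 * n)))
      \<le> ?b * (exp (2 * V * ln (n + 1)) * exp (lam\<^sup>2 * c\<^sup>2 / (8 * n)))"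
      using b growth by (intro mult_left_mono mult_right_mono) auto
    also have "\<dots> = exp (2 * V * ln (n + 1) - T) / lam"
      unfolding 1 by (simp flip: exp_add)
    also have "\<dots> \<le> exp (- t - 2 * ln 2 - ln n) / lam"
      using key lam by (intro divide_right_mono) (auto simp: T_def)
    also have "exp (- t - 2 * ln 2 - ln n) = exp (- t) / (4 * n)"
      using n ln_realpow[of 2 2, symmetric] by (simp add: exp_diff)
    also have "exp (- t) / (4 * n) / lam \<le> exp (- t) / (4 * n) / 1"
    proof (intro divide_left_mono)
      have "1 * 4 \<le> (n * a) * 4" using a0 n by (simp add: field_simps)
      moreover have "c\<^sup>2 \<le> 2\<^sup>2" using c by (intro power_mono) auto
      ultimately have "c\<^sup>2 \<le> 4 * n * a" by simp
      then show "1 \<le> lam" using c by (simp add: lam_def)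
    qed (use lam in auto)
    finally show "?b * (real (n * (n + 1) + 1) ^ V * exp (lam\<^sup>2 * c\<^sup>2 / (8 * n)))
      \<le> exp (- t) / (4 * real n)" by simp
  qed
  finally show ?thesis .
qed

end

section \<open>The deviation of a single frequency\<close>

text \<open>The deviation is centred, so its positive part has half the mean of its absolute value, which is
  bounded by the standard deviation.\<close>
lemma integral_freq_excess_le:
  assumes P: "prob_space P" and C[measurable]: "C \<in> sets P" and n: "n > 0"
  shows "(\<integral>z. max 0 (freq n z C - measure P C) \<partial>PiM {..<n} (\<lambda>_. P))
    \<le> sqrt (measure P C) / sqrt (2 * real n)"
proof -
  let ?M = "PiM {..<n} (\<lambda>_. P)"
  interpret prob_space P by (rule P)
  interpret M: prob_space ?M by (intro prob_space_PiM P)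
  interpret prod: product_sigma_finite "\<lambda>_::nat. P"
    by (intro product_sigma_finite.intro) unfold_locales
  define q where "q = prob C"
  have q: "0 \<le> q" "q \<le> 1" by (simp_all add: q_def)
  define X where "X x = indicat_real C x - q" for x
  have Xm[measurable]: "X \<in> borel_measurable P" unfolding X_def[abs_def] by measurable
  have Xb: "\<bar>X x\<bar> \<le> 1" for x using q by (auto simp: X_def indicator_def)
  have Xint: "integrable P X" by (rule integrable_const_bound[where B = 1]) (use Xb in auto)
  have Cint: "integrable P (indicat_real C)"
    by (rule integrable_const_bound[where B = 1]) (auto simp: indicator_def[abs_def] intro: measurable_If_set)
  have EX: "(\<integral>x. X x \<partial>P) = 0"
    unfolding X_def using Cint C by (simp add: q_def prob_space)
  have EX2: "(\<integral>x. X x * X x \<partial>P) \<le> q"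
  proof -
    have "X x * X x = (1 - 2 * q) * indicat_real C x + q\<^sup>2" for x
      by (auto simp: X_def indicator_def power2_eq_square algebra_simps)
    then have "(\<integral>x. X x * X x \<partial>P) = (1 - 2 * q) * q + q\<^sup>2"
      using Cint C by (simp add: q_def prob_space)
    also have "\<dots> \<le> q" using q by (simp add: power2_eq_square algebra_simps)
    finally show ?thesis .
  qed
  have XXint: "integrable P (\<lambda>x. X x * X x)"
    by (rule integrable_const_bound[where B = 1])
      (use abs_square_le_1 Xb in \<open>auto simp: power2_eq_square[symmetric]\<close>)
  have cov: "integrable ?M (\<lambda>z. X (z i) * X (z j)) \<and>
      (\<integral>z. X (z i) * X (z j) \<partial>?M) \<le> (if i = j then q else 0)"
    if ij: "i < n" "j < n" for i j
  proof -
    define F where "F k x = (if k = i then X x else 1) * (if k = j then X x else 1)" for k :: nat and x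
    have Fint: "integrable P (F k)" for k
      unfolding F_def using Xint XXint by (cases "k = i"; cases "k = j") auto
    have FX: "X (z i) * X (z j) = (\<Prod>k<n. F k (z k))" for z
      using ij by (simp add: F_def prod.distrib prod.delta)
    have "integrable ?M (\<lambda>z. \<Prod>k<n. F k (z k))"
      by (intro prod.product_integrable_prod Fint) auto
    moreover have "(\<integral>z. (\<Prod>k<n. F k (z k)) \<partial>?M) = (\<Prod>k<n. \<integral>x. F k x \<partial>P)"
      by (intro prod.product_integral_prod Fint) auto
    moreover have "(\<Prod>k<n. \<integral>x. F k x \<partial>P) \<le> (if i = j then q else 0)"
    proof (cases "i = j")
      case True
      have "(\<integral>x. F k x \<partial>P) = (if k = i then \<integral>x. X x * X x \<partial>P else 1)" for k
        using True by (simp add: F_def prob_space)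
      then show ?thesis using ij True EX2 by (simp add: prod.delta)
    next
      case False
      then have "(\<integral>x. F i x \<partial>P) = 0" by (simp add: F_def EX)
      then have "(\<Prod>k<n. \<integral>x. F k x \<partial>P) = 0" using ij by (auto intro: prod_zero)
      then show ?thesis using False by (simp only: if_False order_refl)
    qed
    ultimately show ?thesis by (simp add: FX)
  qed
  define Y where "Y z = freq n z C - q" for z
  have Y: "Y z = (\<Sum>i<n. X (z i)) / n" for z
    using n by (simp add: Y_def freq_def X_def sum_subtractf diff_divide_distrib)
  have Yb: "\<bar>Y z\<bar> \<le> 1" for z
    using q freq_nonneg[of n z C] freq_le_1[of n z C] by (simp add: Y_def abs_le_iff)
  have Ym[measurable]: "Y \<in> borel_measurable ?M"
    unfolding Y[abs_def] by measurable
  have Yint: "integrable ?M Y" by (rule M.integrable_const_bound[where B = 1]) (use Yb in auto)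
  have EY: "(\<integral>z. Y z \<partial>?M) = 0"
  proof -
    have c: "integrable ?M (\<lambda>z. X (z i)) \<and> (\<integral>z. X (z i) \<partial>?M) = 0" if "i < n" for i
    proof
      have d: "distr ?M P (\<lambda>z. z i) = P"
        using that by (intro distr_PiM_component) (unfold_locales, auto)
      have m: "(\<lambda>z. z i) \<in> measurable ?M P" using that by simp
      show "integrable ?M (\<lambda>z. X (z i))"
        using that by (intro M.integrable_const_bound[where B = 1]) (use Xb in auto)
      show "(\<integral>z. X (z i) \<partial>?M) = 0"
        using integral_distr[OF m, of X] d EX by simp
    qed
    then show ?thesis unfolding Y by (simp add: Bochner_Integration.integral_sum)
  qed
  have EY2: "(\<integral>z. (Y z)\<^sup>2 \<partial>?M) \<le> q / n"
  proof -
    have "(\<integral>z. (\<Sum>i<n. \<Sum>j<n. X (z i) * X (z j)) \<partial>?M)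
        = (\<Sum>i<n. \<integral>z. (\<Sum>j<n. X (z i) * X (z j)) \<partial>?M)"
      using cov by (intro Bochner_Integration.integral_sum Bochner_Integration.integrable_sum) auto
    also have "\<dots> = (\<Sum>i<n. \<Sum>j<n. \<integral>z. X (z i) * X (z j) \<partial>?M)"
      using cov by (intro sum.cong refl Bochner_Integration.integral_sum) auto
    finally have swap: "(\<integral>z. (\<Sum>i<n. \<Sum>j<n. X (z i) * X (z j)) \<partial>?M)
        = (\<Sum>i<n. \<Sum>j<n. \<integral>z. X (z i) * X (z j) \<partial>?M)" .
    have "(Y z)\<^sup>2 = (\<Sum>i<n. \<Sum>j<n. X (z i) * X (z j)) / (n * n)" for z
      by (simp add: Y power2_eq_square sum_product)
    then have "(\<integral>z. (Y z)\<^sup>2 \<partial>?M) = (\<integral>z. (\<Sum>i<n. \<Sum>j<n. X (z i) * X (z j)) \<partial>?M) / (n * n)"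
      by simp
    also have "\<dots> = (\<Sum>i<n. \<Sum>j<n. \<integral>z. X (z i) * X (z j) \<partial>?M) / (n * n)"
      by (simp only: swap)
    also have "\<dots> \<le> (\<Sum>i<n. \<Sum>j<n. if i = j then q else 0) / (n * n)"
      using cov by (intro divide_right_mono sum_mono) auto
    also have "\<dots> = q / n" using n by simp
    finally show ?thesis .
  qed
  have "(\<integral>z. \<bar>Y z\<bar> \<partial>?M) \<le> sqrt (q / n)"
  proof (rule real_le_rsqrt)
    have "0 \<le> M.variance (\<lambda>z. \<bar>Y z\<bar>)" by (rule M.variance_positive)
    also have "\<dots> = (\<integral>z. \<bar>Y z\<bar>\<^sup>2 \<partial>?M) - (\<integral>z. \<bar>Y z\<bar> \<partial>?M)\<^sup>2"
    proof (rule M.variance_eq)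
      show "integrable ?M (\<lambda>z. \<bar>Y z\<bar>\<^sup>2)"
        by (rule M.integrable_const_bound[where B = 1])
          (use abs_square_le_1 Yb in auto)
    qed (use Yint in simp)
    finally show "(\<integral>z. \<bar>Y z\<bar> \<partial>?M)\<^sup>2 \<le> q / n" using EY2 by simp
  qed
  moreover have "(\<integral>z. max 0 (Y z) \<partial>?M) = (\<integral>z. \<bar>Y z\<bar> \<partial>?M) / 2"
  proof -
    have "max 0 (Y z) = (Y z + \<bar>Y z\<bar>) / 2" for z by (simp add: max_def)
    then have "(\<integral>z. max 0 (Y z) \<partial>?M) = (\<integral>z. (Y z + \<bar>Y z\<bar>) / 2 \<partial>?M)"
      by (simp only:)
    also have "\<dots> = (\<integral>z. \<bar>Y z\<bar> \<partial>?M) / 2" using Yint EY by simp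
    finally show ?thesis .
  qed
  moreover have "sqrt (q / n) / 2 \<le> sqrt q / sqrt (2 * real n)"
  proof -
    have "sqrt 2 \<le> 2" using real_sqrt_le_mono[of 2 4] by simp
    then have "sqrt q / sqrt n / 2 \<le> sqrt q / sqrt n / sqrt 2"
      using q by (intro divide_left_mono) auto
    then show ?thesis by (simp add: real_sqrt_divide real_sqrt_mult mult.commute)
  qed
  ultimately have "(\<integral>z. max 0 (Y z) \<partial>?M) \<le> sqrt q / sqrt (2 * real n)" by linarith
  then show ?thesis by (simp only: Y_def q_def)
qed

section \<open>Classes of classifiers\<close>

lemma error_set_measurable:
  fixes P :: "(bool \<times> (real ^ 'p)) measure"
  assumes "sets P = sets obs_space" and g: "g \<in> classifiers"
  shows "error_set g \<in> sets P"
proof -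
  note [measurable] = g
  have "{z \<in> space obs_space. g (snd z) \<noteq> fst z} \<in> sets obs_space" by measurable
  moreover have "{z \<in> space obs_space. g (snd z) \<noteq> fst z} = error_set g"
    by (auto simp: error_set_def space_pair_measure)
  ultimately show ?thesis by (simp only: assms(1))
qed

text \<open>The labels of the sample take finitely many values; once they are fixed, a trace prescribes the
  values of a classifier at the feature vectors.\<close>
lemma traces_error_sets_measurable:
  fixes P :: "(bool \<times> (real ^ 'p)) measure"
  assumes P: "sets P = sets obs_space" and G: "measurable_class G"
  shows "{w \<in> space (PiM {..<m} (\<lambda>_. P)). B \<in> traces (error_set ` G) m w}
    \<in> sets (PiM {..<m} (\<lambda>_. P))"
proof (cases "B \<subseteq> {..<m}")
  case False
  then have "{w \<in> space (PiM {..<m} (\<lambda>_. P)). B \<in> traces (error_set ` G) m w} = {}"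
    by (auto simp: traces_def)
  then show ?thesis by (simp only: sets.empty_sets)
next
  case B: True
  let ?M = "PiM {..<m} (\<lambda>_. P)" and ?N = "PiM {..<m} (\<lambda>_. borel :: (real ^ 'p) measure)"
  define features where "features w = (\<lambda>i\<in>{..<m}. snd (w i :: bool \<times> (real ^ 'p)))" for w
  have sndP: "snd \<in> measurable P borel"
    using measurable_snd[of "count_space (UNIV :: bool set)" borel]
    by (simp add: measurable_cong_sets[OF P refl])
  have fstP: "fst \<in> measurable P (count_space UNIV)"
    using measurable_fst[of "count_space (UNIV :: bool set)" borel]
    by (simp add: measurable_cong_sets[OF P refl])
  have comp: "(\<lambda>w. w i) \<in> measurable ?M P" if "i < m" for i
    using that by (intro measurable_component_singleton) simp
  have features[measurable]: "features \<in> measurable ?M ?N"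
    unfolding features_def[abs_def]
    by (intro measurable_restrict measurable_compose[OF comp sndP]) auto
  let ?R = "\<lambda>Y. {x \<in> space ?N. \<exists>g\<in>G. \<forall>i<m. g (x i) = ((i \<in> Y) \<noteq> (i \<in> B))}"
  let ?L = "\<lambda>Y. {w \<in> space ?M. \<forall>i\<in>{..<m}. fst (w i) = (i \<in> Y)}"
  have R: "?R Y \<in> sets ?N" for Y
    using G[unfolded measurable_class_def, rule_format, of m "\<lambda>i. (i \<in> Y) \<noteq> (i \<in> B)"] .
  have L: "?L Y \<in> sets ?M" for Y
  proof (rule sets.sets_Collect_finite_All)
    fix i assume i: "i \<in> {..<m}"
    have "(\<lambda>w. fst (w i)) \<in> measurable ?M (count_space UNIV)"
      using i by (intro measurable_compose[OF comp fstP]) auto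
    from measurable_sets[OF this, of "{i \<in> Y}"]
    show "{w \<in> space ?M. fst (w i) = (i \<in> Y)} \<in> sets ?M"
      by (simp add: vimage_def Int_def conj_commute)
  qed simp
  have "{w \<in> space ?M. B \<in> traces (error_set ` G) m w}
      = (\<Union>Y\<in>Pow {..<m}. ?L Y \<inter> (features -` ?R Y \<inter> space ?M))"
  proof (intro set_eqI iffI)
    fix w assume "w \<in> {w \<in> space ?M. B \<in> traces (error_set ` G) m w}"
    then obtain g where w: "w \<in> space ?M" and g: "g \<in> G" "B = {k. k < m \<and> w k \<in> error_set g}"
      by (auto simp: traces_def)
    let ?Y = "{i. i < m \<and> fst (w i)}"
    have fs: "features w \<in> space ?N" using measurable_space[OF features w] .
    have "g (features w i) = ((i \<in> ?Y) \<noteq> (i \<in> B))" if "i < m" for i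
      using that g(2) by (auto simp: features_def error_set_def case_prod_beta)
    then have "features w \<in> ?R ?Y" using fs g(1) by blast
    moreover have "w \<in> ?L ?Y" using w by auto
    ultimately show "w \<in> (\<Union>Y\<in>Pow {..<m}. ?L Y \<inter> (features -` ?R Y \<inter> space ?M))"
      using w by (intro UN_I[of ?Y]) auto
  next
    fix w assume "w \<in> (\<Union>Y\<in>Pow {..<m}. ?L Y \<inter> (features -` ?R Y \<inter> space ?M))"
    then obtain Y g where w: "w \<in> space ?M" "\<And>i. i < m \<Longrightarrow> fst (w i) = (i \<in> Y)"
      and g: "g \<in> G" "\<And>i. i < m \<Longrightarrow> g (features w i) = ((i \<in> Y) \<noteq> (i \<in> B))"
      by auto
    have "w i \<in> error_set g \<longleftrightarrow> i \<in> B" if "i < m" for i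
      using w(2)[OF that] g(2)[OF that] that by (auto simp: features_def error_set_def case_prod_beta)
    then have "B = {k. k < m \<and> w k \<in> error_set g}" using B by auto
    then show "w \<in> {w \<in> space ?M. B \<in> traces (error_set ` G) m w}"
      using w g by (auto simp: traces_def)
  qed
  also have "\<dots> \<in> sets ?M"
    by (intro sets.finite_UN sets.Int L measurable_sets[OF features R]) auto
  finally show ?thesis .
qed

lemma class_trimmed_risk_eq_trim:
  assumes P: "prob_space P" and \<alpha>: "0 \<le> \<alpha>" "\<alpha> < 1"
    and err: "\<And>g. g \<in> G \<Longrightarrow> error_set g \<in> sets P"
    and h: "h \<in> G" "\<And>g. g \<in> G \<Longrightarrow> risk P h \<le> risk P g"
  shows "class_trimmed_risk P \<alpha> G = trim \<alpha> (class_risk P G)"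
proof -
  have "class_trimmed_risk P \<alpha> G = (INF g\<in>G. trim \<alpha> (risk P g))"
    unfolding class_trimmed_risk_def by (intro INF_cong refl trimmed_risk_eq_trim P err \<alpha>)
  also have "\<dots> = trim \<alpha> (class_risk P G)"
    unfolding class_risk_def by (rule INF_trim[where f = "risk P", OF \<alpha>(2) h])
  finally show ?thesis .
qed

lemma class_emp_trimmed_risk_eq_trim:
  assumes n: "n > 0" and \<alpha>: "0 \<le> \<alpha>" "\<alpha> < 1" and G: "G \<noteq> {}"
  shows "class_emp_trimmed_risk n z \<alpha> G = trim \<alpha> (min_freq (error_set ` G) n z)"
proof -
  obtain h where h: "h \<in> G" "freq n z (error_set h) = min_freq (error_set ` G) n z"
    using min_freq_attained[of "error_set ` G" n z] G by auto
  have "class_emp_trimmed_risk n z \<alpha> G = (INF g\<in>G. trim \<alpha> (freq n z (error_set g)))"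
    unfolding class_emp_trimmed_risk_def by (intro INF_cong refl emp_trimmed_risk_eq_trim n \<alpha>)
  also have "\<dots> = trim \<alpha> (INF g\<in>G. freq n z (error_set g))"
  proof (rule INF_trim[where f = "\<lambda>g. freq n z (error_set g)", OF \<alpha>(2) h(1)])
    fix g assume "g \<in> G"
    then show "freq n z (error_set h) \<le> freq n z (error_set g)"
      unfolding h(2) by (intro min_freq_le) simp
  qed
  finally show ?thesis by (simp add: min_freq_def image_image)
qed

lemma vc_event_class_error_sets:
  fixes P :: "(bool \<times> (real ^ 'p)) measure"
  assumes P: "prob_space P" "sets P = sets obs_space" and G: "G \<subseteq> classifiers" "G \<noteq> {}"
    and meas: "measurable_class G" and vc: "class_vc_dim G < \<infinity>"
  shows "vc_event_class P (error_set ` G) (the_enat (class_vc_dim G))"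
proof -
  interpret prob_space P by (rule P)
  show ?thesis
  proof
    show "C \<in> sets P" if "C \<in> error_set ` G" for C
      using that G(1) error_set_measurable[OF P(2)] by auto
    show "error_set ` G \<noteq> {}" using G(2) by simp
    show "card A \<le> the_enat (class_vc_dim G)" if "finite A" "shatters (error_set ` G) A" for A
      using that vc unfolding class_vc_dim_def by (intro card_le_vc_dim)
    show "{w \<in> space (PiM {..<m} (\<lambda>_. P)). B \<in> traces (error_set ` G) m w}
        \<in> sets (PiM {..<m} (\<lambda>_. P))" for m B
      by (rule traces_error_sets_measurable[OF P(2) meas])
  qed
qed

lemma pen_eq:
  assumes "\<alpha> < 1"
  shows "pen n t \<alpha> G = (sqrt ((ln (real n) + t) / (2 * real n)) +
    sqrt ((real (the_enat (class_vc_dim G)) * ln (real n + 1) + ln 2) / real n)) / (1 - \<alpha>)"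
proof -
  have "sqrt ((ln (real n) + t) / (2 * real n * (1 - \<alpha>)\<^sup>2))
      = sqrt ((ln (real n) + t) / (2 * real n) / (1 - \<alpha>)\<^sup>2)"
    by simp
  also have "\<dots> = sqrt ((ln (real n) + t) / (2 * real n)) / (1 - \<alpha>)"
    using assms by (subst real_sqrt_divide) simp
  finally show ?thesis by (simp add: pen_def add_divide_distrib)
qed

lemma (in prob_space) distr_iid_sample:
  assumes n: "n > 0" and P: "sets P = sets N"
    and indep: "indep_vars (\<lambda>_. N) \<xi> {..<n}" and distr: "\<And>i. i < n \<Longrightarrow> distr M N (\<xi> i) = P"
  defines "Z \<equiv> \<lambda>\<omega>. \<lambda>i\<in>{..<n}. \<xi> i \<omega>"
  shows "Z \<in> measurable M (PiM {..<n} (\<lambda>_. P))"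
    and "distr M (PiM {..<n} (\<lambda>_. P)) Z = PiM {..<n} (\<lambda>_. P)"
proof -
  have \<xi>: "\<xi> i \<in> measurable M N" if "i < n" for i
    using indep that by (auto simp: indep_vars_def)
  have eq: "sets (PiM {..<n} (\<lambda>_. N)) = sets (PiM {..<n} (\<lambda>_. P))"
    by (intro sets_PiM_cong refl) (simp add: P)
  have "Z \<in> measurable M (PiM {..<n} (\<lambda>_. N))"
    unfolding Z_def using \<xi> by (intro measurable_restrict) auto
  then show "Z \<in> measurable M (PiM {..<n} (\<lambda>_. P))"
    using measurable_cong_sets[OF refl eq] by blast
  have "distr M (PiM {..<n} (\<lambda>_. N)) Z = PiM {..<n} (\<lambda>i. distr M N (\<xi> i))"
    unfolding Z_def using indep n by (subst (asm) indep_vars_iff_distr_eq_PiM') (auto intro: \<xi>)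
  also have "\<dots> = PiM {..<n} (\<lambda>_. P)" by (intro PiM_cong refl) (simp add: distr)
  finally show "distr M (PiM {..<n} (\<lambda>_. P)) Z = PiM {..<n} (\<lambda>_. P)"
    by (subst (asm) distr_cong[OF refl eq refl])
qed

section \<open>Selection of the trimming level and of the class\<close>

theorem theorem3p2:
  fixes M :: "'w measure"
    and P :: "(bool \<times> (real ^ 'p)) measure"
    and \<xi> :: "nat \<Rightarrow> 'w \<Rightarrow> bool \<times> (real ^ 'p)"
    and n :: nat
    and G :: "nat \<Rightarrow> (real ^ 'p \<Rightarrow> bool) set"
    and \<alpha>max \<Sigma>0 :: real
    and x :: "nat \<Rightarrow> real"
    and \<alpha>h :: "'w \<Rightarrow> real"
    and mh :: "'w \<Rightarrow> nat"
  assumes "prob_space M"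
    and "prob_space P"
    and "sets P = sets obs_space"
    and "n > 0"
    and "prob_space.indep_vars M (\<lambda>_. obs_space) \<xi> {..<n}"
    and "\<And>i. i < n \<Longrightarrow> distr M obs_space (\<xi> i) = P"
    and "\<And>m. G m \<subseteq> classifiers"
    and "\<And>m. measurable_class (G m)"
    and "\<And>m. \<exists>g. is_arg_min (risk P) (\<lambda>g. g \<in> G m) g"
    and "\<And>m. class_vc_dim (G m) < \<infinity>"
    and "0 < \<alpha>max" and "\<alpha>max < 1"
    and "\<Sigma>0 \<ge> 0"
    and "\<And>m. x m \<ge> 0"
    and "summable (\<lambda>m. exp (- x m))"
    and "(\<Sum>m. exp (- x m)) \<le> \<Sigma>0"
    and "\<alpha>h \<in> borel_measurable M"
    and "mh \<in> measurable M (count_space UNIV)"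
    and "\<And>\<omega>. \<omega> \<in> space M \<Longrightarrow>
      is_arg_min
        (\<lambda>(\<alpha>, m). class_emp_trimmed_risk n (\<lambda>i. \<xi> i \<omega>) \<alpha> (G m) + pen n (x m) \<alpha> (G m))
        (\<lambda>(\<alpha>, m). (\<alpha>, m) \<in> {0..\<alpha>max} \<times> (UNIV :: nat set))
        (\<alpha>h \<omega>, mh \<omega>)"
  shows "prob_space.expectation M (\<lambda>\<omega>. class_trimmed_risk P (\<alpha>h \<omega>) (G (mh \<omega>)))
    \<le> (INF (\<alpha>, m) \<in> {0..\<alpha>max} \<times> (UNIV :: nat set).
          class_trimmed_risk P \<alpha> (G m) + pen n (x m) \<alpha> (G m)
          + sqrt (class_risk P (G m)) / (sqrt (2 * real n) * (1 - \<alpha>)))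
      + (1 + \<Sigma>0) / (2 * (1 - \<alpha>max)) * sqrt (pi / (2 * real n))
      + 1 / (real n * (1 - \<alpha>max)\<^sup>2)"
proof -
  interpret M: prob_space M by (rule assms(1))
  interpret P: prob_space P by (rule assms(2))
  note sP = assms(3)
  have n: "n > 0" by (rule assms(4))
  have n1: "real n \<ge> 1" using n by simp
  define \<C> where "\<C> k = error_set ` G k" for k
  define V where "V k = the_enat (class_vc_dim (G k))" for k
  define r where "r k = class_risk P (G k)" for k
  define s v where "s k = sqrt ((ln (real n) + x k) / (2 * real n))"
    and "v k = sqrt ((real (V k) * ln (real n + 1) + ln 2) / real n)" for k
  define a where "a k = s k + v k + 1 / real n" for k
  have x0: "0 \<le> x k" for k by (rule assms(14))
  have sv: "0 \<le> s k" "0 \<le> v k" for k using n1 x0[of k] by (auto simp: s_def v_def)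
  have pen_eq: "pen n (x k) \<beta> (G k) = (s k + v k) / (1 - \<beta>)" if "\<beta> < 1" for k \<beta>
    unfolding s_def v_def V_def by (rule pen_eq[OF that])
  have err: "error_set g \<in> sets P" if "g \<in> G k" for g k
    using that assms(7)[of k] by (intro error_set_measurable sP) auto
  have best: "\<exists>h\<in>G k. \<forall>g\<in>G k. risk P h \<le> risk P g" for k
    using assms(9)[of k] by (auto simp: is_arg_min_def not_less)
  then have ne: "G k \<noteq> {}" for k by blast
  have vc: "vc_event_class P (\<C> k) (V k)" for k
    unfolding \<C>_def V_def
    by (rule vc_event_class_error_sets[OF assms(2) sP assms(7) ne assms(8) assms(10)])
  have r_le: "r k \<le> P.prob C" if "C \<in> \<C> k" for k C
  proof -
    from that obtain g where "g \<in> G k" "C = error_set g" by (auto simp: \<C>_def)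
    then show ?thesis unfolding r_def class_risk_def
      by (auto simp: risk_def intro!: cINF_lower bdd_belowI2[where m = 0])
  qed
  have r_attained: "\<exists>h\<in>G k. risk P h = r k" for k
  proof -
    obtain h where h: "h \<in> G k" "\<And>g. g \<in> G k \<Longrightarrow> risk P h \<le> risk P g" using best by blast
    have "r k = risk P h"
      unfolding r_def class_risk_def
      using h by (intro antisym cINF_lower cINF_greatest) (auto intro: bdd_belowI2[where m = "risk P h"])
    then show ?thesis using h by auto
  qed
  have r01: "0 \<le> r k" "r k \<le> 1" for k
    using r_attained[of k] by (metis measure_nonneg risk_def, metis P.prob_le_1 risk_def)
  have trim_class: "class_trimmed_risk P \<beta> (G k) = trim \<beta> (r k)" if \<beta>: "0 \<le> \<beta>" "\<beta> < 1" for \<beta> k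
  proof -
    obtain h where h: "h \<in> G k" "\<And>g. g \<in> G k \<Longrightarrow> risk P h \<le> risk P g" using best by blast
    show ?thesis
      unfolding r_def
      by (rule class_trimmed_risk_eq_trim[OF assms(2) \<beta> _ h]) (use err in auto)
  qed
  have trim_emp: "class_emp_trimmed_risk n z \<beta> (G k) = trim \<beta> (min_freq (\<C> k) n z)"
    if \<beta>: "0 \<le> \<beta>" "\<beta> < 1" for \<beta> k z
    unfolding \<C>_def by (rule class_emp_trimmed_risk_eq_trim[OF n \<beta> ne])
  let ?PM = "PiM {..<n} (\<lambda>_. P)"
  define Z where "Z \<omega> = (\<lambda>i\<in>{..<n}. \<xi> i \<omega>)" for \<omega>
  have Zm: "Z \<in> measurable M ?PM" and distrZ: "distr M ?PM Z = ?PM"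
    using M.distr_iid_sample[OF n sP assms(5,6)] by (simp_all add: Z_def[abs_def])
  have freqZ: "freq n (\<lambda>i. \<xi> i \<omega>) C = freq n (Z \<omega>) C" for \<omega> C
    unfolding freq_def Z_def by (intro arg_cong2[where f = "(/)"] sum.cong) auto
  have min_freqZ: "min_freq (\<C> k) n (\<lambda>i. \<xi> i \<omega>) = min_freq (\<C> k) n (Z \<omega>)" for \<omega> k
    unfolding min_freq_def freqZ ..
  \<comment> \<open>the part of the deviation of class \<open>k\<close> that the penalty and the reserve of \<open>1/n\<close> do not cover\<close>
  define W where "W k z = max 0 (r k - min_freq (\<C> k) n z - a k)" for k z
  have W0: "0 \<le> W k z" for k z by (simp add: W_def)
  have Wm: "W k \<in> borel_measurable ?PM" for k
  proof -
    interpret vc_event_class P "\<C> k" "V k" by (rule vc)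
    show ?thesis unfolding W_def[abs_def] by measurable
  qed
  have EW: "(\<integral>\<^sup>+\<omega>. ennreal (W k (Z \<omega>)) \<partial>M) \<le> ennreal (exp (- x k) / (4 * real n))" for k
  proof -
    have "(\<integral>\<^sup>+\<omega>. ennreal (W k (Z \<omega>)) \<partial>M) = (\<integral>\<^sup>+z. ennreal (W k z) \<partial>distr M ?PM Z)"
      using Wm by (intro nn_integral_distr[symmetric] Zm) simp
    also have "\<dots> = (\<integral>\<^sup>+z. ennreal (W k z) \<partial>?PM)" by (simp only: distrZ)
    also have "\<dots> \<le> ennreal (exp (- x k) / (4 * real n))"
      unfolding W_def a_def s_def v_def
      by (rule vc_event_class.expected_excess_le[OF vc n x0 r_le])
    finally show ?thesis .
  qed
  have am: "0 < \<alpha>max" "\<alpha>max < 1" by (rule assms(11), rule assms(12))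
  let ?c = "1 / (1 - \<alpha>max)"
  let ?L = "M.expectation (\<lambda>\<omega>. class_trimmed_risk P (\<alpha>h \<omega>) (G (mh \<omega>)))"
  let ?rhs = "\<lambda>\<alpha> m. class_trimmed_risk P \<alpha> (G m) + pen n (x m) \<alpha> (G m)
          + sqrt (class_risk P (G m)) / (sqrt (2 * real n) * (1 - \<alpha>))"
  let ?rest = "(1 + \<Sigma>0) / (2 * (1 - \<alpha>max)) * sqrt (pi / (2 * real n))
      + 1 / (real n * (1 - \<alpha>max)\<^sup>2)"
  have \<alpha>h: "0 \<le> \<alpha>h \<omega>" "\<alpha>h \<omega> \<le> \<alpha>max" "\<alpha>h \<omega> < 1" if "\<omega> \<in> space M" for \<omega>
    using assms(19)[OF that] am by (auto simp: is_arg_min_def)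
  have main: "?L \<le> ?rhs \<alpha> m + ?rest" if \<alpha>: "0 \<le> \<alpha>" "\<alpha> \<le> \<alpha>max" for \<alpha> m
  proof -
    have \<alpha>1: "\<alpha> < 1" using \<alpha> am by simp
    obtain h where h: "h \<in> G m" "risk P h = r m" using r_attained by blast
    define C where "C = error_set h"
    have C: "C \<in> \<C> m" "C \<in> sets P" "P.prob C = r m"
      using h err by (auto simp: C_def \<C>_def risk_def)
    interpret vc_event_class P "\<C> m" "V m" by (rule vc)
    \<comment> \<open>the empirical minimum is at most the frequency of this one event, so its deviation suffices\<close>
    define U where "U z = max 0 (freq n z C - r m)" for z
    have Um: "U \<in> borel_measurable ?PM"
      unfolding U_def[abs_def] freq_def using C(2) by measurable
    have Ub: "0 \<le> U z" "U z \<le> 1" for z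
      using freq_le_1[of n z C] r01[of m] by (auto simp: U_def)
    have EU: "(\<integral>\<^sup>+\<omega>. ennreal (U (Z \<omega>)) \<partial>M) \<le> ennreal (sqrt (r m) / sqrt (2 * real n))"
    proof -
      interpret PM: prob_space ?PM by (rule prob_space_power)
      have "(\<integral>\<^sup>+\<omega>. ennreal (U (Z \<omega>)) \<partial>M) = (\<integral>\<^sup>+z. ennreal (U z) \<partial>distr M ?PM Z)"
        using Um by (intro nn_integral_distr[symmetric] Zm) simp
      also have "\<dots> = (\<integral>\<^sup>+z. ennreal (U z) \<partial>?PM)" by (simp only: distrZ)
      also have "\<dots> = ennreal (\<integral>z. U z \<partial>?PM)"
        using Ub Um by (intro nn_integral_eq_integral PM.integrable_const_bound[where B = 1]) auto
      also have "\<dots> \<le> ennreal (sqrt (r m) / sqrt (2 * real n))"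
        using integral_freq_excess_le[OF assms(2) C(2) n] by (intro ennreal_leI) (simp add: U_def C(3))
      finally show ?thesis .
    qed
    define A where "A = trim \<alpha> (r m) + pen n (x m) \<alpha> (G m) + ?c / n"
    have A0: "0 \<le> A"
      using am \<alpha>1 sv[of m] unfolding A_def pen_eq[OF \<alpha>1]
      by (intro add_nonneg_nonneg trim_nonneg divide_nonneg_nonneg) auto
    have pointwise: "trim (\<alpha>h \<omega>) (r (mh \<omega>)) \<le> A + U (Z \<omega>) / (1 - \<alpha>) + ?c * W (mh \<omega>) (Z \<omega>)"
      if \<omega>: "\<omega> \<in> space M" for \<omega>
    proof -
      let ?b = "\<alpha>h \<omega>" and ?k = "mh \<omega>"
      note b = \<alpha>h[OF \<omega>]
      let ?f = "\<lambda>k. min_freq (\<C> k) n (Z \<omega>)"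
      have "trim ?b (r ?k) \<le> trim ?b (?f ?k) + max 0 (r ?k - ?f ?k) / (1 - ?b)"
        by (rule trim_diff_le[OF b(3)])
      moreover have "trim ?b (?f ?k) + (s ?k + v ?k) / (1 - ?b) \<le> trim \<alpha> (?f m) + pen n (x m) \<alpha> (G m)"
        using assms(19)[OF \<omega>] b \<alpha> \<alpha>1
        by (auto simp: is_arg_min_def trim_emp pen_eq min_freqZ not_less)
      moreover have "trim \<alpha> (?f m) \<le> trim \<alpha> (freq n (Z \<omega>) C)"
        by (intro trim_mono \<alpha>1 min_freq_le C)
      moreover have "trim \<alpha> (freq n (Z \<omega>) C) \<le> trim \<alpha> (r m) + U (Z \<omega>) / (1 - \<alpha>)"
        unfolding U_def by (rule trim_diff_le[OF \<alpha>1])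
      moreover have "max 0 (r ?k - ?f ?k) / (1 - ?b) - (s ?k + v ?k) / (1 - ?b)
          \<le> ?c / n + ?c * W ?k (Z \<omega>)"
      proof -
        have "max 0 (r ?k - ?f ?k) - (s ?k + v ?k) \<le> 1 / n + W ?k (Z \<omega>)"
        proof -
          have "0 \<le> 1 / real n" by simp
          then show ?thesis using sv[of ?k] unfolding W_def a_def by linarith
        qed
        then have "(max 0 (r ?k - ?f ?k) - (s ?k + v ?k)) / (1 - ?b) \<le> (1 / n + W ?k (Z \<omega>)) / (1 - ?b)"
          using b by (intro divide_right_mono) auto
        also have "\<dots> \<le> (1 / n + W ?k (Z \<omega>)) / (1 - \<alpha>max)"
          using b am W0[of ?k "Z \<omega>"] by (intro divide_left_mono) auto
        also have "\<dots> = ?c / n + ?c * W ?k (Z \<omega>)" by (simp add: add_divide_distrib mult.commute)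
        finally show ?thesis by (simp add: diff_divide_distrib)
      qed
      ultimately show ?thesis unfolding A_def by linarith
    qed
    define B where "B = A + sqrt (r m) / sqrt (2 * real n) / (1 - \<alpha>) + ?c * (\<Sigma>0 / (4 * n))"
    have rm0: "0 \<le> sqrt (r m) / sqrt (2 * real n)" using r01 by simp
    have B0: "0 \<le> B"
      using A0 rm0 r01[of m] \<alpha>1 am assms(13) unfolding B_def
      by (intro add_nonneg_nonneg mult_nonneg_nonneg divide_nonneg_nonneg) auto
    have "(\<integral>\<^sup>+\<omega>. ennreal (trim (\<alpha>h \<omega>) (r (mh \<omega>))) \<partial>M)
      \<le> (\<integral>\<^sup>+\<omega>. (ennreal A + ennreal (1 / (1 - \<alpha>)) * ennreal (U (Z \<omega>)))
            + ennreal ?c * (\<Sum>k. ennreal (W k (Z \<omega>))) \<partial>M)"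
    proof (rule nn_integral_mono)
      fix \<omega> assume \<omega>: "\<omega> \<in> space M"
      have "ennreal (trim (\<alpha>h \<omega>) (r (mh \<omega>)))
          \<le> ennreal (A + 1 / (1 - \<alpha>) * U (Z \<omega>) + ?c * W (mh \<omega>) (Z \<omega>))"
        using pointwise[OF \<omega>] by (intro ennreal_leI) simp
      also have "\<dots> = (ennreal A + ennreal (1 / (1 - \<alpha>)) * ennreal (U (Z \<omega>)))
            + ennreal ?c * ennreal (W (mh \<omega>) (Z \<omega>))"
        using A0 \<alpha>1 am Ub[of "Z \<omega>"] W0[of "mh \<omega>" "Z \<omega>"]
        by (simp add: ennreal_mult[symmetric] ennreal_plus[symmetric] del: ennreal_plus)
      \<comment> \<open>the selected class is random, so its excess is bounded by the sum over all classes\<close>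
      also have "ennreal (W (mh \<omega>) (Z \<omega>)) \<le> (\<Sum>k. ennreal (W k (Z \<omega>)))"
        using sum_le_suminf[of "\<lambda>k. ennreal (W k (Z \<omega>))" "{mh \<omega>}"] by simp
      finally show "ennreal (trim (\<alpha>h \<omega>) (r (mh \<omega>)))
        \<le> (ennreal A + ennreal (1 / (1 - \<alpha>)) * ennreal (U (Z \<omega>)))
            + ennreal ?c * (\<Sum>k. ennreal (W k (Z \<omega>)))"
        by (simp add: add_left_mono mult_left_mono)
    qed
    also have "\<dots> = (ennreal A + ennreal (1 / (1 - \<alpha>)) * (\<integral>\<^sup>+\<omega>. ennreal (U (Z \<omega>)) \<partial>M))
            + ennreal ?c * (\<Sum>k. \<integral>\<^sup>+\<omega>. ennreal (W k (Z \<omega>)) \<partial>M)"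
    proof -
      note [measurable] = measurable_compose[OF Zm Um] measurable_compose[OF Zm Wm]
      show ?thesis
        by (simp add: nn_integral_add nn_integral_cmult nn_integral_suminf M.emeasure_space_1)
    qed
    also have "\<dots> \<le> (ennreal A + ennreal (1 / (1 - \<alpha>)) * ennreal (sqrt (r m) / sqrt (2 * real n)))
            + ennreal ?c * ennreal (\<Sigma>0 / (4 * n))"
    proof -
      have "(\<Sum>k. \<integral>\<^sup>+\<omega>. ennreal (W k (Z \<omega>)) \<partial>M) \<le> (\<Sum>k. ennreal (exp (- x k) / (4 * real n)))"
        by (intro suminf_le EW) auto
      also have "\<dots> = ennreal (\<Sum>k. exp (- x k) / (4 * real n))"
        by (rule suminf_ennreal2) (use assms(15) in \<open>auto intro: summable_divide\<close>)
      also have "\<dots> = ennreal ((\<Sum>k. exp (- x k)) / (4 * real n))"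
        using suminf_divide[OF assms(15), of "4 * real n"] by simp
      also have "\<dots> \<le> ennreal (\<Sigma>0 / (4 * n))"
        using assms(16) by (intro ennreal_leI) (simp add: divide_right_mono)
      finally show ?thesis using EU by (intro add_mono mult_left_mono) auto
    qed
    also have "\<dots> = ennreal B"
      using A0 \<alpha>1 am rm0 r01[of m] assms(13) unfolding B_def
      by (simp add: ennreal_mult[symmetric] ennreal_plus[symmetric] del: ennreal_plus)
    finally have nnB: "(\<integral>\<^sup>+\<omega>. ennreal (trim (\<alpha>h \<omega>) (r (mh \<omega>))) \<partial>M) \<le> ennreal B" .
    have "?L = M.expectation (\<lambda>\<omega>. trim (\<alpha>h \<omega>) (r (mh \<omega>)))"
      by (intro Bochner_Integration.integral_cong refl trim_class \<alpha>h)
    also have "\<dots> = enn2real (\<integral>\<^sup>+\<omega>. ennreal (trim (\<alpha>h \<omega>) (r (mh \<omega>))) \<partial>M)"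
    proof (rule integral_eq_nn_integral)
      note [measurable] = assms(17) assms(18)
      have [measurable]: "(\<lambda>\<omega>. r (mh \<omega>)) \<in> borel_measurable M" by measurable
      show "(\<lambda>\<omega>. trim (\<alpha>h \<omega>) (r (mh \<omega>))) \<in> borel_measurable M"
        unfolding trim_def by measurable
    qed (simp add: trim_nonneg)
    also have "\<dots> \<le> B" by (rule enn2real_leI[OF B0 nnB])
    also have "B \<le> ?rhs \<alpha> m + ?rest"
    proof -
      have "?c / n \<le> 1 / (real n * (1 - \<alpha>max)\<^sup>2)"
      proof -
        have "(1 - \<alpha>max)\<^sup>2 \<le> 1 - \<alpha>max"
          using am mult_left_le[of "1 - \<alpha>max" "1 - \<alpha>max"] by (simp add: power2_eq_square)
        then have "1 / (real n * (1 - \<alpha>max)) \<le> 1 / (real n * (1 - \<alpha>max)\<^sup>2)"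
          using n am by (intro divide_left_mono mult_left_mono mult_pos_pos) auto
        then show ?thesis by (simp add: mult.commute)
      qed
      moreover have "?c * (\<Sigma>0 / (4 * n)) \<le> (1 + \<Sigma>0) / (2 * (1 - \<alpha>max)) * sqrt (pi / (2 * real n))"
      proof -
        have "1 / (2 * real n) \<le> sqrt (pi / (2 * real n))"
        proof (rule real_le_rsqrt)
          have "1 / (2 * real n) \<le> pi"
            using n1 pi_ge_two by (auto simp: divide_simps intro: order_trans[of 1 "pi * 1"] mult_left_mono)
          then show "(1 / (2 * real n))\<^sup>2 \<le> pi / (2 * real n)"
            using n1 divide_right_mono[of "1 / (2 * real n)" pi "2 * real n"] by (simp add: power2_eq_square)
        qed
        then have "(1 + \<Sigma>0) / (2 * (1 - \<alpha>max)) * (1 / (2 * real n))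
            \<le> (1 + \<Sigma>0) / (2 * (1 - \<alpha>max)) * sqrt (pi / (2 * real n))"
          using am assms(13) by (intro mult_left_mono) auto
        moreover have "?c * (\<Sigma>0 / (4 * n)) \<le> (1 + \<Sigma>0) / (2 * (1 - \<alpha>max)) * (1 / (2 * real n))"
        proof -
          have "\<Sigma>0 / (4 * n * (1 - \<alpha>max)) \<le> (1 + \<Sigma>0) / (4 * n * (1 - \<alpha>max))"
            using am by (intro divide_right_mono) auto
          then show ?thesis by (simp add: mult_ac)
        qed
        ultimately show ?thesis by linarith
      qed
      ultimately show ?thesis
        unfolding B_def A_def trim_class[OF \<alpha>(1) \<alpha>1] r_def[symmetric] by simp
    qed
    finally show ?thesis .
  qed
  have "?L - ?rest \<le> (INF (\<alpha>, m) \<in> {0..\<alpha>max} \<times> (UNIV :: nat set). ?rhs \<alpha> m)"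
  proof (rule cINF_greatest)
    show "{0..\<alpha>max} \<times> (UNIV :: nat set) \<noteq> {}" using am by simp
    fix y assume "y \<in> {0..\<alpha>max} \<times> (UNIV :: nat set)"
    then obtain \<alpha> m where y: "y = (\<alpha>, m)" "0 \<le> \<alpha>" "\<alpha> \<le> \<alpha>max" by auto
    show "?L - ?rest \<le> (case y of (\<alpha>, m) \<Rightarrow> ?rhs \<alpha> m)"
      using main[OF y(2,3), of m] unfolding y(1) by simp
  qed
  then show ?thesis by linarith
qed

end
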